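(* Let $\sigma:\Sigma\to\Sigma$ be a transitive subshift of finite type. Let $\varphi\in C^0(\Sigma,\mathbb Q)$ be a locally constant function which is not cohomologous to a constant, and let $A\in C^0(\Sigma)$ be a Walters function. For each $c\in\mathbb R$ and each $\epsilon>0$, there exist a rational number $r\in\mathrm{int}(\varphi_*(\mathcal M_\sigma))$ and a periodic probability measure $\mu\in\varphi_*^{-1}(r)$ satisfying $$c r-\int A\,d\mu<\alpha_{A,\varphi}(c)+\epsilon.$$
   Context: $\Sigma$ is a one-sided subshift of finite type over a finite alphabet, with points $\mathbf x=(x_0,x_1,\dots)$ and shift map $\sigma$; it carries the metric $d(\mathbf x,\mathbf y)=\lambda^k$, $k=\min\{j:x_j\ne y_j\}$ (and $d(\mathbf x,\mathbf x)=0$), for a fixed $\lambda\in(0,1)$. $\mathcal M_\sigma$ is the set of $\sigma$-invariant Borel probability measures. For $\varphi\in C^0(\Sigma)$ and $\mu\in\mathcal M_\sigma$, $\varphi_*(\mu)=\int\varphi\,d\mu$, and $\varphi_*^{-1}(r)=\{\mu\in\mathcal M_\sigma:\varphi_*(\mu)=r\}$; $\mathrm{int}$ is the interior in $\mathbb R$. $C^0(\Sigma,\mathbb Q)$ denotes the continuous real functions on $\Sigma$ with values in $\mathbb Q$. For $h\in\varphi_*(\mathcal M_\sigma)$, $\beta_{A,\varphi}(h)=\sup\{\int A\,d\mu:\mu\in\varphi_*^{-1}(h)\}$, and for $c\in\mathbb R$, $\alpha_{A,\varphi}(c)=\min_{h\in\varphi_*(\mathcal M_\sigma)}[ch-\beta_{A,\varphi}(h)]$.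 Two functions in $C^0(\Sigma)$ are cohomologous if their difference equals $f\circ\sigma-f$ for some $f\in C^0(\Sigma)$. A continuous function $g$ on $\Sigma$ is locally constant if there is an integer $j\ge0$ such that $g(\mathbf x)=g(\mathbf y)$ whenever $x_0=y_0,\dots,x_j=y_j$. Put $S_kf=\sum_{j=0}^{k-1}f\circ\sigma^j$ and $d_k(\mathbf x,\mathbf y)=\max_{0\le j<k}d(\sigma^j\mathbf x,\sigma^j\mathbf y)$. A function $f\in C^0(\Sigma)$ is a Walters function (Walters potential) if there is an increasing function $H:\mathbb R^+\to\mathbb R^+\cup\{+\infty\}$, null and continuous at zero, such that for all $s\in\mathbb R^+$, $k>0$, $\mathbf x,\mathbf y\in\Sigma$: $d_k(\mathbf x,\mathbf y)\le s$ implies $|S_kf(\mathbf x)-S_kf(\mathbf y)|\le H(s)$. A periodic probability measure is a measure of the form $\frac1M\sum_{j=0}^{M-1}\delta_{\sigma^j(\mathbf x)}$ with $\mathbf x$ a periodic point of period $M$. *)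

theory Defs
  imports "HOL-Probability.Probability"
begin

definition shift :: "(nat \<Rightarrow> 'a) \<Rightarrow> nat \<Rightarrow> 'a" where
  "shift x = (\<lambda>n. x (Suc n))"

(* The set of sequences in which no word of a finite set F of forbidden words occurs. *)
definition subshift_of_finite_type :: "(nat \<Rightarrow> 'a::finite) set \<Rightarrow> bool" where
  "subshift_of_finite_type X \<longleftrightarrow>
     (\<exists>F :: 'a list set. finite F \<and>
        X = {x. \<forall>w\<in>F. \<forall>n. map x [n..<n + length w] \<noteq> w})"

definition seq_dist :: "real \<Rightarrow> (nat \<Rightarrow> 'a) \<Rightarrow> (nat \<Rightarrow> 'a) \<Rightarrow> real" where
  "seq_dist lam x y = (if x = y then 0 else lam ^ (LEAST j. x j \<noteq> y j))"

lemma seq_dist_commute: "seq_dist lam x y = seq_dist lam y x"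
  by (auto simp: seq_dist_def eq_commute)

lemma seq_dist_triangle:
  assumes "0 < lam" "lam < 1"
  shows "seq_dist lam x z \<le> seq_dist lam x y + seq_dist lam y z"
proof (cases "x = y \<or> y = z \<or> x = z")
  case True
  then show ?thesis using assms by (auto simp: seq_dist_def)
next
  case False
  define i j k where "i = (LEAST n. x n \<noteq> z n)" and "j = (LEAST n. x n \<noteq> y n)"
    and "k = (LEAST n. y n \<noteq> z n)"
  have "x i \<noteq> z i" unfolding i_def by (rule LeastI_ex) (use False in auto)
  then have "x i \<noteq> y i \<or> y i \<noteq> z i" by auto
  then have "j \<le> i \<or> k \<le> i" unfolding j_def k_def by (auto intro: Least_le)
  then have "lam ^ i \<le> lam ^ j \<or> lam ^ i \<le> lam ^ k"
    using assms by (auto intro: power_decreasing)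
  moreover have "0 < lam ^ j" "0 < lam ^ k" using assms by auto
  ultimately show ?thesis
    using False unfolding seq_dist_def i_def j_def k_def by auto
qed

lemma Metric_space_seq_dist:
  assumes "0 < lam" "lam < 1"
  shows "Metric_space X (seq_dist lam)"
proof
  fix x y z :: "nat \<Rightarrow> 'a"
  show "0 \<le> seq_dist lam x y" using assms by (simp add: seq_dist_def)
  show "seq_dist lam x y = seq_dist lam y x" by (rule seq_dist_commute)
  show "(seq_dist lam x y = 0) = (x = y)" using assms by (simp add: seq_dist_def)
  show "seq_dist lam x z \<le> seq_dist lam x y + seq_dist lam y z"
    using assms by (rule seq_dist_triangle)
qed

definition shift_topology :: "real \<Rightarrow> (nat \<Rightarrow> 'a) set \<Rightarrow> (nat \<Rightarrow> 'a) topology" where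
  "shift_topology lam X = Metric_space.mtopology X (seq_dist lam)"

definition transitive_shift :: "real \<Rightarrow> (nat \<Rightarrow> 'a) set \<Rightarrow> bool" where
  "transitive_shift lam X \<longleftrightarrow>
     (\<forall>U V. openin (shift_topology lam X) U \<and> U \<noteq> {} \<and>
            openin (shift_topology lam X) V \<and> V \<noteq> {} \<longrightarrow>
        (\<exists>n. \<exists>x\<in>U. (shift ^^ n) x \<in> V))"

(* Functions on X are total functions, of which only the values on X matter. *)
definition C0 :: "real \<Rightarrow> (nat \<Rightarrow> 'a) set \<Rightarrow> ((nat \<Rightarrow> 'a) \<Rightarrow> real) set" where
  "C0 lam X = {f. continuous_map (shift_topology lam X) euclideanreal f}"

definition C0_rat :: "real \<Rightarrow> (nat \<Rightarrow> 'a) set \<Rightarrow> ((nat \<Rightarrow> 'a) \<Rightarrow> real) set" where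
  "C0_rat lam X = {f \<in> C0 lam X. f ` X \<subseteq> \<rat>}"

definition locally_constant :: "(nat \<Rightarrow> 'a) set \<Rightarrow> ((nat \<Rightarrow> 'a) \<Rightarrow> real) \<Rightarrow> bool" where
  "locally_constant X g \<longleftrightarrow>
     (\<exists>j. \<forall>x\<in>X. \<forall>y\<in>X. (\<forall>i\<le>j. x i = y i) \<longrightarrow> g x = g y)"

definition cohomologous ::
  "real \<Rightarrow> (nat \<Rightarrow> 'a) set \<Rightarrow> ((nat \<Rightarrow> 'a) \<Rightarrow> real) \<Rightarrow> ((nat \<Rightarrow> 'a) \<Rightarrow> real) \<Rightarrow> bool" where
  "cohomologous lam X g h \<longleftrightarrow>
     (\<exists>f\<in>C0 lam X. \<forall>x\<in>X. g x - h x = f (shift x) - f x)"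

definition birkhoff_sum :: "nat \<Rightarrow> ((nat \<Rightarrow> 'a) \<Rightarrow> real) \<Rightarrow> (nat \<Rightarrow> 'a) \<Rightarrow> real" where
  "birkhoff_sum k f x = (\<Sum>j<k. f ((shift ^^ j) x))"

(* Only used for k > 0. *)
definition bowen_dist :: "real \<Rightarrow> nat \<Rightarrow> (nat \<Rightarrow> 'a) \<Rightarrow> (nat \<Rightarrow> 'a) \<Rightarrow> real" where
  "bowen_dist lam k x y = Max ((\<lambda>j. seq_dist lam ((shift ^^ j) x) ((shift ^^ j) y)) ` {..<k})"

(* The values of H at negative arguments are irrelevant. *)
definition walters :: "real \<Rightarrow> (nat \<Rightarrow> 'a) set \<Rightarrow> ((nat \<Rightarrow> 'a) \<Rightarrow> real) \<Rightarrow> bool" where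
  "walters lam X f \<longleftrightarrow> f \<in> C0 lam X \<and>
     (\<exists>H :: real \<Rightarrow> ennreal. mono_on {0..} H \<and> H 0 = 0 \<and> continuous (at 0 within {0..}) H \<and>
        (\<forall>s\<ge>0. \<forall>k>0. \<forall>x\<in>X. \<forall>y\<in>X. bowen_dist lam k x y \<le> s \<longrightarrow>
           ennreal \<bar>birkhoff_sum k f x - birkhoff_sum k f y\<bar> \<le> H s))"

definition shift_borel :: "real \<Rightarrow> (nat \<Rightarrow> 'a) set \<Rightarrow> (nat \<Rightarrow> 'a) measure" where
  "shift_borel lam X = sigma X {U. openin (shift_topology lam X) U}"

definition invariant_measures :: "real \<Rightarrow> (nat \<Rightarrow> 'a) set \<Rightarrow> (nat \<Rightarrow> 'a) measure set" where
  "invariant_measures lam X =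
     {\<mu>. prob_space \<mu> \<and> sets \<mu> = sets (shift_borel lam X) \<and> distr \<mu> \<mu> shift = \<mu>}"

definition integral_range :: "real \<Rightarrow> (nat \<Rightarrow> 'a) set \<Rightarrow> ((nat \<Rightarrow> 'a) \<Rightarrow> real) \<Rightarrow> real set" where
  "integral_range lam X \<phi> = (\<lambda>\<mu>. integral\<^sup>L \<mu> \<phi>) ` invariant_measures lam X"

definition integral_fiber ::
  "real \<Rightarrow> (nat \<Rightarrow> 'a) set \<Rightarrow> ((nat \<Rightarrow> 'a) \<Rightarrow> real) \<Rightarrow> real \<Rightarrow> (nat \<Rightarrow> 'a) measure set" where
  "integral_fiber lam X \<phi> r = {\<mu> \<in> invariant_measures lam X. integral\<^sup>L \<mu> \<phi> = r}"

definition beta_fun ::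
  "real \<Rightarrow> (nat \<Rightarrow> 'a) set \<Rightarrow> ((nat \<Rightarrow> 'a) \<Rightarrow> real) \<Rightarrow> ((nat \<Rightarrow> 'a) \<Rightarrow> real) \<Rightarrow> real \<Rightarrow> real" where
  "beta_fun lam X A \<phi> h = (SUP \<mu>\<in>integral_fiber lam X \<phi> h. integral\<^sup>L \<mu> A)"

(* A minimum over an infinite set, hence Least (not Min, which is for finite sets). *)
definition alpha_fun ::
  "real \<Rightarrow> (nat \<Rightarrow> 'a) set \<Rightarrow> ((nat \<Rightarrow> 'a) \<Rightarrow> real) \<Rightarrow> ((nat \<Rightarrow> 'a) \<Rightarrow> real) \<Rightarrow> real \<Rightarrow> real" where
  "alpha_fun lam X A \<phi> c =
     (LEAST m. m \<in> (\<lambda>h. c * h - beta_fun lam X A \<phi> h) ` integral_range lam X \<phi>)"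

(* return N x is the Dirac measure at x; the two conditions determine the measure. *)
definition periodic_measure :: "real \<Rightarrow> (nat \<Rightarrow> 'a) set \<Rightarrow> (nat \<Rightarrow> 'a) measure \<Rightarrow> bool" where
  "periodic_measure lam X \<mu> \<longleftrightarrow>
     (\<exists>x\<in>X. \<exists>M>0. (shift ^^ M) x = x \<and> sets \<mu> = sets (shift_borel lam X) \<and>
        (\<forall>B\<in>sets \<mu>. emeasure \<mu> B =
           ennreal (1 / real M) *
             (\<Sum>j<M. emeasure (return (shift_borel lam X) ((shift ^^ j) x)) B)))"

end

theory Submission
  imports Defs "HOL-Complex_Analysis.Great_Picard"
begin

text \<open>Put \<open>g = c * \<phi> - A\<close>. The number \<open>c * h - beta_fun lam X A \<phi> h\<close> is the infimum of the
  integrals of \<open>g\<close> over the invariant measures in the fibre over \<open>h\<close>, so \<open>alpha_fun lam X A \<phi> c\<close>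
  is the smallest integral of \<open>g\<close> over all invariant measures. The proof compares this with the
  infimum \<open>a\<close> of the averages of \<open>g\<close> over periodic orbits.

  No invariant measure integrates \<open>g\<close> to less than \<open>a\<close>: the integral of \<open>g\<close> is that of the
  Birkhoff average of any length \<open>n\<close>, and by transitivity every orbit segment is shadowed by a
  periodic orbit whose period exceeds its length by a bounded amount, so that Birkhoff sums over
  segments of length \<open>n\<close> are at least \<open>n * (a - e)\<close> up to a constant
  (\<open>orbit_closing\<close>, \<open>integral_ge_Inf_periodic_averages\<close>). Conversely, \<open>a\<close> is attained, because
  the invariant measures are sequentially compact (\<open>invariant_measures_seq_compact\<close>). Hence
  \<open>alpha_fun lam X A \<phi> c = a\<close>, and some periodic orbit has \<open>g\<close>-average below \<open>a + \<epsilon> / 2\<close>.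

  The \<open>\<phi>\<close>-average \<open>k\<close> of this orbit may be an end point of the interval of all integrals of \<open>\<phi>\<close>.
  If every path that leaves a long prefix of the orbit and returns to it had \<open>\<phi>\<close>-average \<open>k\<close>, the
  sums of \<open>\<phi> - k\<close> along paths would depend on their end points only and would define a transfer
  function between \<open>\<phi>\<close> and \<open>k\<close> (\<open>cohomologous_constant_if_return_averages_equal\<close>). So there is a
  return path of a different average \<open>d\<close>. Running many times through the orbit and then once
  through this path gives a periodic orbit whose \<open>g\<close>-average has hardly changed, while its
  \<open>\<phi>\<close>-average lies strictly between \<open>k\<close> and \<open>d\<close>, hence in the interior of the interval
  (\<open>perturb_average_into_interior\<close>). It is rational as an average of finitely many rational
  values.\<close>

section \<open>Symbolic sequences\<close>

definition agree :: "nat \<Rightarrow> (nat \<Rightarrow> 'a) \<Rightarrow> (nat \<Rightarrow> 'a) \<Rightarrow> bool" where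
  "agree N x y \<longleftrightarrow> (\<forall>i<N. x i = y i)"

text \<open>In a subshift of finite type, paths can be concatenated and loops can be closed up as soon as
  sufficiently long overlaps match; \<open>glue\<close> and \<open>periodize\<close> perform these two operations, and their
  results agree with the original sequence well beyond the place of surgery.\<close>

definition glue :: "nat \<Rightarrow> (nat \<Rightarrow> 'a) \<Rightarrow> (nat \<Rightarrow> 'a) \<Rightarrow> nat \<Rightarrow> 'a" where
  "glue n x y = (\<lambda>i. if i < n then x i else y (i - n))"

definition periodize :: "nat \<Rightarrow> (nat \<Rightarrow> 'a) \<Rightarrow> nat \<Rightarrow> 'a" where
  "periodize n x = (\<lambda>i. x (i mod n))"

lemma funpow_shift_apply: "(shift ^^ n) x i = x (n + i)"
  by (induction n arbitrary: i) (auto simp: shift_def)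

lemma funpow_shift_add: "(shift ^^ m) ((shift ^^ n) x) = (shift ^^ (m + n)) x"
  by (simp add: funpow_add)

lemma agree_refl [simp]: "agree N x x"
  by (simp add: agree_def)

lemma agree_sym: "agree N x y \<Longrightarrow> agree N y x"
  by (simp add: agree_def)

lemma agree_trans: "agree N x y \<Longrightarrow> agree N y z \<Longrightarrow> agree N x z"
  by (simp add: agree_def)

lemma agree_mono: "agree N x y \<Longrightarrow> M \<le> N \<Longrightarrow> agree M x y"
  by (auto simp: agree_def)

lemma agree_funpow_shift: "agree (k + N) x y \<Longrightarrow> agree N ((shift ^^ k) x) ((shift ^^ k) y)"
  by (auto simp: agree_def funpow_shift_apply)

lemma agree_shift: "agree (Suc N) x y \<Longrightarrow> agree N (shift x) (shift y)"
  by (auto simp: agree_def shift_def)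

lemma agree_iff_map_eq: "agree N x y \<longleftrightarrow> map x [0..<N] = map y [0..<N]"
  by (auto simp: agree_def)

lemma funpow_shift_glue: "(shift ^^ n) (glue n x y) = y"
  by (rule ext) (simp add: glue_def funpow_shift_apply)

lemma agree_glue:
  assumes "agree m ((shift ^^ n) x) y"
  shows "agree (n + m) (glue n x y) x"
  unfolding agree_def
proof (intro allI impI)
  fix i assume "i < n + m"
  then show "glue n x y i = x i"
    using assms[unfolded agree_def funpow_shift_apply, rule_format, of "i - n"]
    by (auto simp: glue_def)
qed

lemma funpow_shift_periodize: "(shift ^^ n) (periodize n x) = periodize n x"
  by (rule ext) (simp add: periodize_def funpow_shift_apply)

lemma funpow_shift_periodize_mod:
  "(shift ^^ (i mod n)) (periodize n x) = (shift ^^ i) (periodize n x)"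
  by (rule ext) (simp add: periodize_def funpow_shift_apply mod_simps)

text \<open>The match at time \<open>n\<close> says that \<open>x\<close> itself looks \<open>n\<close>-periodic up to time \<open>n + m\<close>, so the
  periodic sequence follows it over the whole of this range.\<close>

lemma agree_periodize:
  assumes "0 < n" and "agree m ((shift ^^ n) x) x"
  shows "agree (n + m) (periodize n x) x"
  unfolding agree_def
proof (intro allI impI)
  fix i assume "i < n + m"
  then show "periodize n x i = x i"
  proof (induction i rule: less_induct)
    case (less i)
    show ?case
    proof (cases "i < n")
      case False
      then have "x i = x (i - n)"
        using assms(2) less.prems unfolding agree_def funpow_shift_apply
        by (metis add_diff_inverse_nat add_less_imp_less_left)
      moreover have "periodize n x (i - n) = x (i - n)"
        using less False assms(1) by simp
      moreover have "i mod n = (i - n) mod n"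
        using False by (simp add: le_mod_geq)
      ultimately show ?thesis by (simp add: periodize_def)
    qed (simp add: periodize_def)
  qed
qed

lemma finite_prefixes: "finite (range (\<lambda>x :: nat \<Rightarrow> 'a::finite. map x [0..<N]))"
  by (rule finite_subset[OF _ finite_lists_length_eq[of UNIV N]]) auto

text \<open>Compactness of the full shift: a diagonal argument applied to the finitely many values
  of each coordinate, which are coded by numbers so that convergence of coordinates means that
  they are eventually constant.\<close>

lemma full_shift_seq_compact:
  fixes x :: "nat \<Rightarrow> nat \<Rightarrow> 'a::finite"
  obtains k y where "strict_mono (k :: nat \<Rightarrow> nat)"
    "\<And>N. eventually (\<lambda>n. agree N (x (k n)) y) sequentially"
proof -
  \<comment> \<open>Codes of distinct letters are at distance at least 1.\<close>
  define c :: "'a \<Rightarrow> real" where "c = real \<circ> to_nat"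
  have inj: "a = b" if "\<bar>c a - c b\<bar> < 1" for a b
  proof -
    have "to_nat a = to_nat b" using that unfolding c_def comp_def by linarith
    then show ?thesis by simp
  qed
  define B where "B = Max (range (\<lambda>a. \<bar>c a\<bar>))"
  have B: "norm (c (x n i)) \<le> B" for n i
    unfolding B_def by (auto intro!: Max_ge)
  obtain k where k: "strict_mono (k :: nat \<Rightarrow> nat)"
      and lim: "\<And>i. \<exists>l. (\<lambda>n. c (x (k n) i)) \<longlonglongrightarrow> l"
    by (rule function_convergent_subsequence[of "UNIV :: nat set" "\<lambda>n i. c (x n i)" B])
      (use B in simp_all)
  have "\<exists>a. eventually (\<lambda>n. x (k n) i = a) sequentially" for i
  proof -
    obtain l where "(\<lambda>n. c (x (k n) i)) \<longlonglongrightarrow> l" using lim by blast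
    then obtain M where M: "\<And>n. n \<ge> M \<Longrightarrow> \<bar>c (x (k n) i) - l\<bar> < 1/2"
      using LIMSEQ_D[of _ l "1/2"] by (metis half_gt_zero_iff real_norm_def zero_less_one)
    have "x (k n) i = x (k M) i" if "n \<ge> M" for n
      using M[OF that] M[OF order_refl] by (intro inj) linarith
    then show ?thesis unfolding eventually_sequentially by blast
  qed
  then obtain y where y: "\<And>i. eventually (\<lambda>n. x (k n) i = y i) sequentially" by metis
  have "eventually (\<lambda>n. agree N (x (k n)) y) sequentially" for N
    unfolding agree_def using y
    by (subst eventually_ball_finite_distrib[of "{..<N}", unfolded Ball_def lessThan_iff]) auto
  with k that show thesis by blast
qed

section \<open>The topology and the Borel sets of a sequence space\<close>

locale sequence_space =
  fixes X :: "(nat \<Rightarrow> 'a::finite) set" and lam :: real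
  assumes lam_pos: "0 < lam" and lam_less_1: "lam < 1"
begin

lemma seq_dist_less_imp_agree:
  assumes "seq_dist lam x y < lam ^ N" shows "agree N x y"
proof (rule ccontr)
  assume "\<not> agree N x y"
  then obtain i where i: "i < N" "x i \<noteq> y i" by (auto simp: agree_def)
  then have "(LEAST j. x j \<noteq> y j) \<le> N" using Least_le[of "\<lambda>j. x j \<noteq> y j" i] by simp
  then have "lam ^ N \<le> lam ^ (LEAST j. x j \<noteq> y j)"
    using lam_pos lam_less_1 by (simp add: power_decreasing)
  with assms i show False by (cases "x = y") (auto simp: seq_dist_def)
qed

lemma agree_imp_seq_dist_le:
  assumes "agree N x y" shows "seq_dist lam x y \<le> lam ^ N"
proof (cases "x = y")
  case False
  then have "x (LEAST j. x j \<noteq> y j) \<noteq> y (LEAST j. x j \<noteq> y j)"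
    by (intro LeastI_ex[of "\<lambda>j. x j \<noteq> y j"]) auto
  then have "N \<le> (LEAST j. x j \<noteq> y j)"
    using assms unfolding agree_def by (meson not_le)
  then show ?thesis
    using False lam_pos lam_less_1 by (simp add: seq_dist_def power_decreasing)
qed (use lam_pos in \<open>simp add: seq_dist_def\<close>)

lemma small_power: "0 < r \<Longrightarrow> \<exists>N. lam ^ N < r"
  using lam_less_1 real_arch_pow_inv by blast

sublocale seq: Metric_space X "seq_dist lam"
  using lam_pos lam_less_1 by (rule Metric_space_seq_dist)

text \<open>The topology does not depend on \<open>lam\<close>, because the balls are the sets of points with a common
  prefix.\<close>

lemma openin_shift_topology:
  "openin (shift_topology lam X) U \<longleftrightarrow>
    U \<subseteq> X \<and> (\<forall>x\<in>U. \<exists>N. \<forall>y\<in>X. agree N x y \<longrightarrow> y \<in> U)"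
proof -
  have "(\<exists>r>0. seq.mball x r \<subseteq> U) \<longleftrightarrow> (\<exists>N. \<forall>y\<in>X. agree N x y \<longrightarrow> y \<in> U)"
    if "U \<subseteq> X" "x \<in> U" for x
  proof
    assume "\<exists>r>0. seq.mball x r \<subseteq> U"
    then obtain r where r: "r > 0" "seq.mball x r \<subseteq> U" by blast
    obtain N where "lam ^ N < r" using small_power r(1) by blast
    then show "\<exists>N. \<forall>y\<in>X. agree N x y \<longrightarrow> y \<in> U"
      using r(2) that agree_imp_seq_dist_le[of N x] by (intro exI[of _ N]) (force simp: seq.mball_def)
  next
    assume "\<exists>N. \<forall>y\<in>X. agree N x y \<longrightarrow> y \<in> U"
    then obtain N where "\<forall>y\<in>X. agree N x y \<longrightarrow> y \<in> U" by blast
    then show "\<exists>r>0. seq.mball x r \<subseteq> U"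
      using lam_pos seq_dist_less_imp_agree[of x _ N]
      by (intro exI[of _ "lam ^ N"]) (auto simp: seq.mball_def)
  qed
  then show ?thesis
    unfolding shift_topology_def seq.openin_mtopology by blast
qed

lemma topspace_shift_topology: "topspace (shift_topology lam X) = X"
  by (simp add: shift_topology_def)

lemma C0_iff:
  "f \<in> C0 lam X \<longleftrightarrow> (\<forall>x\<in>X. \<forall>e>0. \<exists>N. \<forall>y\<in>X. agree N x y \<longrightarrow> \<bar>f x - f y\<bar> < e)"
proof -
  have "(\<exists>\<delta>>0. \<forall>y. y \<in> X \<and> seq_dist lam x y < \<delta> \<longrightarrow> dist (f x) (f y) < e) \<longleftrightarrow>
      (\<exists>N. \<forall>y\<in>X. agree N x y \<longrightarrow> \<bar>f x - f y\<bar> < e)" (is "?l \<longleftrightarrow> ?r") for x e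
  proof
    assume ?l
    then obtain \<delta> where \<delta>: "\<delta> > 0" "\<And>y. y \<in> X \<Longrightarrow> seq_dist lam x y < \<delta> \<Longrightarrow> dist (f x) (f y) < e"
      by blast
    obtain N where "lam ^ N < \<delta>" using small_power \<delta>(1) by blast
    then show ?r
      using \<delta>(2) agree_imp_seq_dist_le[of N x] by (intro exI[of _ N]) (force simp: dist_real_def)
  next
    assume ?r
    then obtain N where "\<forall>y\<in>X. agree N x y \<longrightarrow> \<bar>f x - f y\<bar> < e" by blast
    then show ?l
      using lam_pos seq_dist_less_imp_agree[of x _ N]
      by (intro exI[of _ "lam ^ N"]) (auto simp: dist_real_def)
  qed
  then show ?thesis
    unfolding C0_def shift_topology_def mem_Collect_eq mtopology_is_euclidean[symmetric]
    by (subst seq.metric_continuous_map[OF Met_TC.Metric_space_axioms]) simp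
qed

text \<open>The sets that are determined by finitely many coordinates; when \<open>X\<close> is compact, these are
  exactly its clopen sets. They form a countable algebra that generates the Borel sets, and
  compactness will turn finitely additive set functions on it into measures.\<close>

definition clopen :: "nat \<Rightarrow> (nat \<Rightarrow> 'a) set \<Rightarrow> bool" where
  "clopen N B \<longleftrightarrow> B \<subseteq> X \<and> (\<forall>x\<in>B. \<forall>y\<in>X. agree N x y \<longrightarrow> y \<in> B)"

definition clopens :: "(nat \<Rightarrow> 'a) set set" where
  "clopens = {B. \<exists>N. clopen N B}"

lemma clopen_mono: "clopen N B \<Longrightarrow> N \<le> M \<Longrightarrow> clopen M B"
  unfolding clopen_def using agree_mono by blast

lemma clopens_openin: "B \<in> clopens \<Longrightarrow> openin (shift_topology lam X) B"
  unfolding clopens_def clopen_def openin_shift_topology by blast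

lemma cylinder_clopens: "{y \<in> X. agree N x y} \<in> clopens"
  unfolding clopens_def clopen_def using agree_trans by blast

lemma algebra_clopens: "algebra X clopens"
  unfolding algebra_iff_Un
proof (intro conjI ballI)
  show "clopens \<subseteq> Pow X" "{} \<in> clopens" by (auto simp: clopens_def clopen_def)
next
  fix B assume "B \<in> clopens"
  then obtain N where "clopen N B" by (auto simp: clopens_def)
  then have "clopen N (X - B)" unfolding clopen_def using agree_sym by blast
  then show "X - B \<in> clopens" unfolding clopens_def by blast
next
  fix B C assume "B \<in> clopens" "C \<in> clopens"
  then obtain N M where "clopen N B" "clopen M C" by (auto simp: clopens_def)
  then have "clopen (max N M) B" "clopen (max N M) C" by (auto intro: clopen_mono)
  then have "clopen (max N M) (B \<union> C)" unfolding clopen_def by blast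
  then show "B \<union> C \<in> clopens" unfolding clopens_def by blast
qed

lemma countable_clopens: "countable clopens"
proof -
  let ?p = "\<lambda>N x :: nat \<Rightarrow> 'a. map x [0..<N]"
  have "finite {B. clopen N B}" for N
  proof (rule inj_on_finite)
    show "inj_on (image (?p N)) {B. clopen N B}"
    proof (rule inj_onI)
      have "B \<subseteq> C" if BC: "clopen N B" "clopen N C" "?p N ` B = ?p N ` C" for B C
      proof
        fix x assume x: "x \<in> B"
        then have "?p N x \<in> ?p N ` C" using BC(3) by blast
        then obtain y where y: "y \<in> C" "agree N y x" unfolding agree_iff_map_eq by force
        have "x \<in> X" using BC(1) x by (auto simp: clopen_def)
        then show "x \<in> C" using BC(2) y unfolding clopen_def by blast
      qed
      then show "B = C" if "B \<in> {B. clopen N B}" "C \<in> {B. clopen N B}" "?p N ` B = ?p N ` C" for B C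
        using that by (intro subset_antisym) simp_all
    qed
    show "image (?p N) ` {B. clopen N B} \<subseteq> Pow (range (?p N))" by blast
    show "finite (Pow (range (?p N)))" using finite_prefixes by blast
  qed
  moreover have "clopens = (\<Union>N. {B. clopen N B})" by (auto simp: clopens_def)
  ultimately show ?thesis by (simp add: countable_finite)
qed

lemma openin_UN_clopens:
  assumes "openin (shift_topology lam X) U"
  obtains D where "\<And>N::nat. D N \<in> clopens" "U = (\<Union>N. D N)"
proof
  define D where "D N = {x\<in>X. \<forall>y\<in>X. agree N x y \<longrightarrow> y \<in> U}" for N
  show "D N \<in> clopens" for N
  proof -
    have "clopen N (D N)" unfolding clopen_def D_def using agree_trans by blast
    then show ?thesis by (auto simp: clopens_def)
  qed
  show "U = (\<Union>N. D N)"
    using assms unfolding D_def openin_shift_topology by (auto 4 4 simp: subset_iff)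
qed

abbreviation SB :: "(nat \<Rightarrow> 'a) measure" where "SB \<equiv> shift_borel lam X"

lemma space_SB [simp]: "space SB = X"
  unfolding shift_borel_def by (simp add: space_measure_of_conv)

lemma opens_subset_Pow: "{U. openin (shift_topology lam X) U} \<subseteq> Pow X"
  by (auto simp: openin_shift_topology)

lemma sets_SB: "sets SB = sigma_sets X {U. openin (shift_topology lam X) U}"
  unfolding shift_borel_def using opens_subset_Pow by (rule sets_measure_of)

lemma openin_sets_SB: "openin (shift_topology lam X) U \<Longrightarrow> U \<in> sets SB"
  by (simp add: sets_SB)

lemma clopens_sets_SB: "B \<in> clopens \<Longrightarrow> B \<in> sets SB"
  by (simp add: openin_sets_SB clopens_openin)

lemma sets_SB_clopens: "sets SB = sigma_sets X clopens"
proof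
  interpret S: sigma_algebra X "sigma_sets X clopens"
    by (rule sigma_algebra_sigma_sets) (auto simp: clopens_def clopen_def)
  show "sets SB \<subseteq> sigma_sets X clopens"
    unfolding sets_SB
  proof (rule S.sigma_sets_subset, rule subsetI)
    fix U assume "U \<in> {U. openin (shift_topology lam X) U}"
    then obtain D where D: "\<And>N::nat. D N \<in> clopens" "U = (\<Union>N. D N)"
      using openin_UN_clopens[of U] by auto
    then show "U \<in> sigma_sets X clopens" by (auto intro!: S.countable_UN)
  qed
  show "sigma_sets X clopens \<subseteq> sets SB"
    using sets.sigma_sets_subset[of clopens SB] clopens_sets_SB by auto
qed

lemma C0_measurable: "f \<in> C0 lam X \<Longrightarrow> f \<in> borel_measurable SB"
proof (rule borel_measurableI)
  fix S :: "real set" assume f: "f \<in> C0 lam X" and "open S"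
  then have "openin (shift_topology lam X) {x \<in> topspace (shift_topology lam X). f x \<in> S}"
    unfolding C0_def by (intro openin_continuous_map_preimage) auto
  then show "f -` S \<inter> space SB \<in> sets SB"
    by (intro openin_sets_SB) (simp add: topspace_shift_topology vimage_def Int_def conj_commute)
qed

end

section \<open>Gluing and closing orbits in a subshift of finite type\<close>

lemma birkhoff_sum_add:
  "birkhoff_sum (n + p) f x = birkhoff_sum n f x + birkhoff_sum p f ((shift ^^ n) x)"
proof -
  have "(\<Sum>j<n + p. f ((shift ^^ j) x)) =
      (\<Sum>j<n. f ((shift ^^ j) x)) + (\<Sum>j<p. f ((shift ^^ (j + n)) x))"
    by (induction p) (auto simp: add.commute)
  then show ?thesis by (simp add: birkhoff_sum_def funpow_shift_add)
qed

lemma birkhoff_sum_mult_period: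
  assumes "(shift ^^ M) x = x"
  shows "(shift ^^ (K * M)) x = x" and "birkhoff_sum (K * M) f x = real K * birkhoff_sum M f x"
proof -
  show *: "(shift ^^ (K * M)) x = x" for K
    by (induction K) (simp_all add: funpow_add assms)
  show "birkhoff_sum (K * M) f x = real K * birkhoff_sum M f x"
  proof (induction K)
    case (Suc K)
    have "birkhoff_sum (Suc K * M) f x = birkhoff_sum (K * M + M) f x" by (simp add: add.commute)
    also have "\<dots> = birkhoff_sum (K * M) f x + birkhoff_sum M f x"
      by (simp only: birkhoff_sum_add *)
    finally show ?case using Suc by (simp add: algebra_simps)
  qed (simp add: birkhoff_sum_def)
qed

definition determined_by :: "nat \<Rightarrow> (nat \<Rightarrow> 'a) set \<Rightarrow> ((nat \<Rightarrow> 'a) \<Rightarrow> real) \<Rightarrow> bool" where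
  "determined_by N X f \<longleftrightarrow> (\<forall>x\<in>X. \<forall>y\<in>X. agree N x y \<longrightarrow> f x = f y)"

lemma locally_constant_imp_determined_by:
  assumes "locally_constant X f" obtains N where "determined_by N X f"
proof -
  obtain j where "\<forall>x\<in>X. \<forall>y\<in>X. (\<forall>i\<le>j. x i = y i) \<longrightarrow> f x = f y"
    using assms unfolding locally_constant_def by blast
  then have "determined_by (Suc j) X f" unfolding determined_by_def agree_def less_Suc_eq_le .
  then show thesis ..
qed

lemma determined_by_mono: "determined_by N X f \<Longrightarrow> N \<le> M \<Longrightarrow> determined_by M X f"
  unfolding determined_by_def using agree_mono by blast

text \<open>Both uniform continuity and local constancy are used through this bound; the case \<open>e = 0\<close> is
  \<open>determined_by\<close>.\<close>

definition oscillation_below ::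
  "nat \<Rightarrow> real \<Rightarrow> (nat \<Rightarrow> 'a) set \<Rightarrow> ((nat \<Rightarrow> 'a) \<Rightarrow> real) \<Rightarrow> bool" where
  "oscillation_below N e X f \<longleftrightarrow> (\<forall>x\<in>X. \<forall>y\<in>X. agree N x y \<longrightarrow> \<bar>f x - f y\<bar> \<le> e)"

lemma oscillation_below_mono:
  "oscillation_below N e X f \<Longrightarrow> N \<le> M \<Longrightarrow> oscillation_below M e X f"
  unfolding oscillation_below_def using agree_mono by blast

lemma determined_by_iff_oscillation: "determined_by N X f \<longleftrightarrow> oscillation_below N 0 X f"
  by (simp add: determined_by_def oscillation_below_def)

locale sft = sequence_space +
  assumes finite_type: "subshift_of_finite_type X"
begin

lemma funpow_shift_in_X:
  assumes "x \<in> X" shows "(shift ^^ n) x \<in> X"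
proof -
  obtain F where F: "X = {x. \<forall>w\<in>F. \<forall>n. map x [n..<n + length w] \<noteq> w}"
    using finite_type unfolding subshift_of_finite_type_def by blast
  have "map ((shift ^^ n) x) [k..<k + l] = map x [n + k..<(n + k) + l]" for k l
    by (rule nth_equalityI) (auto simp: funpow_shift_apply add.assoc)
  then show ?thesis using assms unfolding F by simp
qed

lemma shift_in_X: "x \<in> X \<Longrightarrow> shift x \<in> X"
  using funpow_shift_in_X[of x 1] by simp

text \<open>Membership in a subshift of finite type can be read off windows of a fixed length: \<open>m\<close> is a memory
  if every sequence whose windows of length \<open>m\<close> all occur in \<open>X\<close> belongs to \<open>X\<close>. Any bound on the
  length of the forbidden words is one, and memories may be enlarged, so that a single \<open>m\<close> can serve
  for gluing and for the oscillation of several functions.\<close>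

definition memory :: "nat \<Rightarrow> bool" where
  "memory m \<longleftrightarrow> (\<forall>y. (\<forall>i. \<exists>z\<in>X. agree m ((shift ^^ i) y) z) \<longrightarrow> y \<in> X)"

lemma memoryD: "memory m \<Longrightarrow> (\<And>i. \<exists>z\<in>X. agree m ((shift ^^ i) y) z) \<Longrightarrow> y \<in> X"
  unfolding memory_def by blast

lemma memory_mono: "memory m \<Longrightarrow> m \<le> n \<Longrightarrow> memory n"
  unfolding memory_def using agree_mono by metis

lemma memory_exists: "\<exists>m. memory m"
proof -
  obtain F :: "'a list set" where fin: "finite F"
    and F: "X = {x. \<forall>w\<in>F. \<forall>n. map x [n..<n + length w] \<noteq> w}"
    using finite_type unfolding subshift_of_finite_type_def by blast
  obtain m where m: "\<And>w. w \<in> F \<Longrightarrow> length w \<le> m"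
    using finite_nat_set_iff_bounded_le[of "length ` F"] fin by auto
  have "memory m"
    unfolding memory_def
  proof (intro allI impI)
    fix y assume y: "\<forall>i. \<exists>z\<in>X. agree m ((shift ^^ i) y) z"
    show "y \<in> X"
      unfolding F
    proof (intro CollectI ballI allI)
      fix w n assume w: "w \<in> F"
      obtain z where z: "z \<in> X" "agree m ((shift ^^ n) y) z" using y by blast
      have "map y [n..<n + length w] = map z [0..<0 + length w]"
      proof (rule nth_equalityI)
        fix i assume "i < length (map y [n..<n + length w])"
        then show "map y [n..<n + length w] ! i = map z [0..<0 + length w] ! i"
          using z(2) m[OF w] by (simp add: agree_def funpow_shift_apply)
      qed simp
      moreover have "map z [0..<0 + length w] \<noteq> w"
        using z(1) w unfolding F by blast
      ultimately show "map y [n..<n + length w] \<noteq> w" by simp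
    qed
  qed
  then show ?thesis ..
qed

lemma X_closed:
  assumes "\<And>N. \<exists>z\<in>X. agree N y z" shows "y \<in> X"
proof -
  obtain m where m: "memory m" using memory_exists ..
  show ?thesis
  proof (rule memoryD[OF m])
    fix i
    obtain z where "z \<in> X" "agree (i + m) y z" using assms by blast
    then show "\<exists>z\<in>X. agree m ((shift ^^ i) y) z"
      using funpow_shift_in_X agree_funpow_shift by blast
  qed
qed

lemma X_seq_compact:
  fixes x :: "nat \<Rightarrow> nat \<Rightarrow> 'a"
  assumes "\<And>n. x n \<in> X"
  obtains k y where "strict_mono (k :: nat \<Rightarrow> nat)" "y \<in> X"
    "\<And>N. eventually (\<lambda>n. agree N (x (k n)) y) sequentially"
proof -
  obtain k y where k: "strict_mono (k :: nat \<Rightarrow> nat)"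
    "\<And>N. eventually (\<lambda>n. agree N (x (k n)) y) sequentially"
    using full_shift_seq_compact[of x] by blast
  moreover have "y \<in> X"
  proof (rule X_closed)
    fix N
    have "\<exists>n. agree N (x (k n)) y"
      using eventually_happens'[OF sequentially_bot k(2)] .
    then show "\<exists>z\<in>X. agree N y z" using assms agree_sym by blast
  qed
  ultimately show thesis using that by blast
qed

lemma C0_eventually:
  assumes "f \<in> C0 lam X" "y \<in> X" "\<And>n. x n \<in> X" "0 < e"
    and "\<And>N. eventually (\<lambda>n. agree N (x n) y) sequentially"
  shows "eventually (\<lambda>n. \<bar>f (x n) - f y\<bar> < e) sequentially"
proof -
  obtain N where "\<forall>z\<in>X. agree N y z \<longrightarrow> \<bar>f y - f z\<bar> < e"
    using assms(1,2,4) unfolding C0_iff by blast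
  then have "\<bar>f (x n) - f y\<bar> < e" if "agree N (x n) y" for n
    using assms(3)[of n] agree_sym[OF that] abs_minus_commute[of "f y"] by simp
  with assms(5)[of N] show ?thesis by (rule eventually_mono)
qed

lemma C0_bounded:
  assumes "f \<in> C0 lam X"
  obtains G where "0 \<le> G" "\<And>x. x \<in> X \<Longrightarrow> \<bar>f x\<bar> \<le> G"
proof -
  have "\<exists>n::nat. \<forall>x\<in>X. \<bar>f x\<bar> \<le> real n"
  proof (rule ccontr)
    assume "\<nexists>n::nat. \<forall>x\<in>X. \<bar>f x\<bar> \<le> real n"
    then obtain x where x: "\<And>n. x n \<in> X" "\<And>n::nat. \<bar>f (x n)\<bar> > real n"
      by (metis not_le)
    then obtain k y where k: "strict_mono k" "y \<in> X"
        "\<And>N. eventually (\<lambda>n. agree N (x (k n)) y) sequentially"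
      using X_seq_compact[of x] by blast
    have "eventually (\<lambda>n. \<bar>f (x (k n)) - f y\<bar> < 1) sequentially"
      using C0_eventually[OF assms k(2), of "\<lambda>n. x (k n)" 1] x(1) k(3) by simp
    moreover have "eventually (\<lambda>n. real n > \<bar>f y\<bar> + 1) sequentially"
      using filterlim_real_sequentially by (simp add: filterlim_at_top_dense)
    ultimately have "eventually (\<lambda>n. False) sequentially"
    proof eventually_elim
      case (elim n)
      moreover have "real n \<le> real (k n)" using seq_suble[OF k(1)] by simp
      ultimately show ?case using x(2)[of "k n"] by linarith
    qed
    then show False by simp
  qed
  then show thesis using that by (metis of_nat_0_le_iff)
qed

lemma C0_oscillation:
  assumes "f \<in> C0 lam X" "0 < e"
  obtains N where "oscillation_below N e X f"
proof -
  have "\<exists>N. oscillation_below N e X f"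
  proof (rule ccontr)
    assume "\<nexists>N. oscillation_below N e X f"
    then have "\<forall>N. \<exists>x y. x \<in> X \<and> y \<in> X \<and> agree N x y \<and> \<bar>f x - f y\<bar> > e"
      unfolding oscillation_below_def by (metis not_le)
    then obtain x y where xy: "\<And>N. x N \<in> X" "\<And>N. y N \<in> X" "\<And>N. agree N (x N) (y N)"
        "\<And>N. \<bar>f (x N) - f (y N)\<bar> > e" by metis
    obtain k z where k: "strict_mono k" "z \<in> X"
        "\<And>N. eventually (\<lambda>n. agree N (x (k n)) z) sequentially"
      using X_seq_compact[of x] xy(1) by blast
    have "eventually (\<lambda>n. agree N (y (k n)) z) sequentially" for N
      using k(3)[of N] eventually_ge_at_top[of N]
    proof eventually_elim
      case (elim n)
      then have "agree N (x (k n)) (y (k n))"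
        using agree_mono[OF xy(3)] seq_suble[OF k(1)] order_trans by blast
      then show ?case using elim(1) agree_sym agree_trans by blast
    qed
    then have "eventually (\<lambda>n. \<bar>f (y (k n)) - f z\<bar> < e/2) sequentially"
      using C0_eventually[OF assms(1) k(2), of "\<lambda>n. y (k n)" "e/2"] xy(2) assms(2) by simp
    moreover have "eventually (\<lambda>n. \<bar>f (x (k n)) - f z\<bar> < e/2) sequentially"
      using C0_eventually[OF assms(1) k(2), of "\<lambda>n. x (k n)" "e/2"] xy(1) k(3) assms(2) by simp
    ultimately have "eventually (\<lambda>n. False) sequentially"
    proof eventually_elim
      case (elim n)
      then show ?case using xy(4)[of "k n"] by linarith
    qed
    then show False by simp
  qed
  then show thesis using that by blast
qed

lemma birkhoff_sum_bound:
  assumes "\<And>x. x \<in> X \<Longrightarrow> \<bar>f x\<bar> \<le> G" "x \<in> X"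
  shows "\<bar>birkhoff_sum n f x\<bar> \<le> real n * G"
proof -
  have "\<bar>birkhoff_sum n f x\<bar> \<le> (\<Sum>j<n. \<bar>f ((shift ^^ j) x)\<bar>)"
    unfolding birkhoff_sum_def by (rule sum_abs)
  also have "\<dots> \<le> (\<Sum>j<n. G)"
    by (intro sum_mono assms(1) funpow_shift_in_X assms(2))
  finally show ?thesis by simp
qed

lemma birkhoff_sum_close:
  assumes "oscillation_below N e X f" "x \<in> X" "y \<in> X" "agree (n + N) x y"
  shows "\<bar>birkhoff_sum n f x - birkhoff_sum n f y\<bar> \<le> real n * e"
proof -
  have "birkhoff_sum n f x - birkhoff_sum n f y =
      (\<Sum>j<n. f ((shift ^^ j) x) - f ((shift ^^ j) y))"
    by (simp add: birkhoff_sum_def sum_subtractf)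
  also have "\<bar>\<dots>\<bar> \<le> (\<Sum>j<n. \<bar>f ((shift ^^ j) x) - f ((shift ^^ j) y)\<bar>)"
    by (rule sum_abs)
  also have "\<dots> \<le> (\<Sum>j<n. e)"
  proof (rule sum_mono)
    fix j assume "j \<in> {..<n}"
    then have "agree N ((shift ^^ j) x) ((shift ^^ j) y)"
      using agree_mono[OF assms(4), of "j + N"] by (intro agree_funpow_shift) simp
    then show "\<bar>f ((shift ^^ j) x) - f ((shift ^^ j) y)\<bar> \<le> e"
      using assms(1-3) funpow_shift_in_X unfolding oscillation_below_def by blast
  qed
  finally show ?thesis by simp
qed

lemma birkhoff_sum_eq:
  assumes "determined_by N X f" "x \<in> X" "y \<in> X" "agree (n + N) x y"
  shows "birkhoff_sum n f x = birkhoff_sum n f y"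
  using birkhoff_sum_close[of N 0 f x y n] assms by (simp add: determined_by_iff_oscillation)

text \<open>Every window of the glued sequence lies either within the range on which it follows \<open>x\<close> or
  entirely in \<open>y\<close>, thanks to the overlap of length \<open>m\<close>.\<close>

lemma glue_in_X:
  assumes m: "memory m" and xy: "x \<in> X" "y \<in> X" and a: "agree m ((shift ^^ n) x) y"
  shows "glue n x y \<in> X"
proof (rule memoryD[OF m])
  fix i
  show "\<exists>z\<in>X. agree m ((shift ^^ i) (glue n x y)) z"
  proof (cases "i < n")
    case True
    then have "agree m ((shift ^^ i) (glue n x y)) ((shift ^^ i) x)"
      using agree_mono[OF agree_glue[OF a], of "i + m"] by (intro agree_funpow_shift) simp
    then show ?thesis using funpow_shift_in_X[OF xy(1)] by blast
  next
    case False
    then have "(shift ^^ i) (glue n x y) = (shift ^^ (i - n)) y"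
      using funpow_shift_add[of "i - n" n "glue n x y"] by (simp add: funpow_shift_glue)
    then show ?thesis using funpow_shift_in_X[OF xy(2)] agree_refl by metis
  qed
qed

lemma periodize_in_X:
  assumes m: "memory m" and x: "x \<in> X" and n: "0 < n" and a: "agree m ((shift ^^ n) x) x"
  shows "periodize n x \<in> X"
proof (rule memoryD[OF m])
  fix i
  have "agree m ((shift ^^ (i mod n)) (periodize n x)) ((shift ^^ (i mod n)) x)"
    using agree_mono[OF agree_periodize[OF n a], of "i mod n + m"] n
    by (intro agree_funpow_shift) simp
  then show "\<exists>z\<in>X. agree m ((shift ^^ i) (periodize n x)) z"
    unfolding funpow_shift_periodize_mod using funpow_shift_in_X[OF x] by blast
qed

end

section \<open>Transitivity and the closing lemma\<close>

locale transitive_sft = sft +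
  assumes transitive: "transitive_shift lam X"
    and nonempty: "X \<noteq> {}"
begin

lemma connecting_point:
  assumes "x \<in> X" "y \<in> X"
  obtains z p where "z \<in> X" "agree m x z" "agree m y ((shift ^^ p) z)"
proof -
  let ?U = "\<lambda>x. {z\<in>X. agree m x z}"
  have "openin (shift_topology lam X) (?U x)" "?U x \<noteq> {}" if "x \<in> X" for x
    using clopens_openin[OF cylinder_clopens] that agree_refl by blast+
  then obtain p z where "z \<in> ?U x" "(shift ^^ p) z \<in> ?U y"
    using transitive assms unfolding transitive_shift_def by meson
  then show thesis using that by blast
qed

text \<open>Only the prefixes of length \<open>m\<close> of the two points matter, and there are finitely many pairs of
  them.\<close>

lemma bounded_connecting_time:
  "\<exists>P. \<forall>x\<in>X. \<forall>y\<in>X. \<exists>z\<in>X. \<exists>p\<le>P. agree m x z \<and> agree m y ((shift ^^ p) z)"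
proof -
  let ?w = "\<lambda>x :: nat \<Rightarrow> 'a. map x [0..<m]"
  define Q where "Q = (\<lambda>(u, v) p. \<exists>z\<in>X. ?w z = u \<and> ?w ((shift ^^ p) z) = v)"
  define W where "W = range ?w \<times> range ?w"
  have "finite W" unfolding W_def by (intro finite_cartesian_product finite_prefixes)
  then obtain P where P: "\<And>uv. uv \<in> W \<Longrightarrow> (LEAST p. Q uv p) \<le> P"
    using finite_nat_set_iff_bounded_le[of "(\<lambda>uv. LEAST p. Q uv p) ` W"] by auto
  have "\<exists>z\<in>X. \<exists>p\<le>P. agree m x z \<and> agree m y ((shift ^^ p) z)" if xy: "x \<in> X" "y \<in> X" for x y
  proof -
    obtain z p where "z \<in> X" "agree m x z" "agree m y ((shift ^^ p) z)"
      using connecting_point[OF xy] by blast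
    then have "Q (?w x, ?w y) p" unfolding Q_def agree_iff_map_eq by auto
    then have "Q (?w x, ?w y) (LEAST p. Q (?w x, ?w y) p)" by (rule LeastI)
    then obtain z where "z \<in> X" "agree m x z"
        "agree m y ((shift ^^ (LEAST p. Q (?w x, ?w y) p)) z)"
      unfolding Q_def agree_iff_map_eq by auto
    moreover have "(LEAST p. Q (?w x, ?w y) p) \<le> P" by (rule P) (auto simp: W_def)
    ultimately show ?thesis by blast
  qed
  then show ?thesis by blast
qed

text \<open>The segment of length \<open>n\<close> of the orbit of \<open>x\<close> is continued by a connecting path back to the prefix
  of \<open>x\<close>, and the resulting loop is closed up. The periodic orbit follows \<open>x\<close> for \<open>n\<close> steps with an
  error of at most \<open>e\<close> per step, and the connecting path, being of bounded length, costs a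
  constant.\<close>

lemma orbit_closing:
  assumes f: "f \<in> C0 lam X" and e: "0 < e"
  obtains C where "\<And>x n. x \<in> X \<Longrightarrow> 0 < n \<Longrightarrow> \<exists>y\<in>X. \<exists>q. n \<le> q \<and> real q \<le> real n + C \<and>
      (shift ^^ q) y = y \<and> \<bar>birkhoff_sum q f y - birkhoff_sum n f x\<bar> \<le> real n * e + C"
proof -
  obtain G where G: "0 \<le> G" "\<And>x. x \<in> X \<Longrightarrow> \<bar>f x\<bar> \<le> G" using C0_bounded[OF f] by blast
  obtain N where N: "oscillation_below N e X f" using C0_oscillation[OF f e] by blast
  obtain k where k: "memory k" using memory_exists ..
  \<comment> \<open>Overlaps of length \<open>m\<close> permit gluing and at the same time keep \<open>f\<close> within \<open>e\<close> up to the last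
    step of the segment.\<close>
  define m where "m = max k N"
  have m: "memory m" and osc: "oscillation_below m e X f"
    using memory_mono[OF k] oscillation_below_mono[OF N] by (auto simp: m_def)
  obtain P where P: "\<And>x y. x \<in> X \<Longrightarrow> y \<in> X \<Longrightarrow>
      \<exists>z\<in>X. \<exists>p\<le>P. agree m x z \<and> agree m y ((shift ^^ p) z)"
    using bounded_connecting_time[of m] by blast
  show thesis
  proof (rule that[of "real P + real P * G"])
    fix x n assume x: "x \<in> X" and n: "0 < (n::nat)"
    obtain z p where z: "z \<in> X" "p \<le> P" "agree m ((shift ^^ n) x) z" "agree m x ((shift ^^ p) z)"
      using P[OF funpow_shift_in_X[OF x] x] by blast
    define w where "w = glue n x z"
    have w: "w \<in> X" unfolding w_def by (rule glue_in_X[OF m x z(1,3)])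
    have wx: "agree (n + m) w x" unfolding w_def by (rule agree_glue[OF z(3)])
    have "(shift ^^ (n + p)) w = (shift ^^ p) z"
      using funpow_shift_add[of p n w] by (simp add: w_def funpow_shift_glue add.commute)
    then have ret: "agree m ((shift ^^ (n + p)) w) w"
      using z(4) agree_mono[OF wx, of m] by (auto intro: agree_trans agree_sym)
    define y where "y = periodize (n + p) w"
    have y: "y \<in> X" unfolding y_def using periodize_in_X[OF m w _ ret] n by simp
    have "agree (n + m) y w"
      using agree_mono[OF agree_periodize[OF _ ret], of "n + m"] n by (simp add: y_def)
    then have "agree (n + m) y x" using wx by (rule agree_trans)
    then have "\<bar>birkhoff_sum n f y - birkhoff_sum n f x\<bar> \<le> real n * e"
      using birkhoff_sum_close[OF osc y x] by blast
    moreover have "\<bar>birkhoff_sum p f ((shift ^^ n) y)\<bar> \<le> real P * G"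
    proof -
      have "\<bar>birkhoff_sum p f ((shift ^^ n) y)\<bar> \<le> real p * G"
        using birkhoff_sum_bound[OF G(2) funpow_shift_in_X[OF y]] .
      also have "\<dots> \<le> real P * G" using z(2) G(1) by (intro mult_right_mono) auto
      finally show ?thesis .
    qed
    ultimately have "\<bar>birkhoff_sum (n + p) f y - birkhoff_sum n f x\<bar> \<le> real n * e + real P * G"
      unfolding birkhoff_sum_add by linarith
    moreover have "(shift ^^ (n + p)) y = y"
      unfolding y_def by (rule funpow_shift_periodize)
    moreover have "0 \<le> real P * G" using G(1) by simp
    ultimately show "\<exists>y\<in>X. \<exists>q. n \<le> q \<and> real q \<le> real n + (real P + real P * G) \<and>
      (shift ^^ q) y = y \<and> \<bar>birkhoff_sum q f y - birkhoff_sum n f x\<bar> \<le> real n * e + (real P + real P * G)"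
      using y z(2) by (intro bexI[of _ y] exI[of _ "n + p"]) auto
  qed
qed

definition periodic_averages :: "((nat \<Rightarrow> 'a) \<Rightarrow> real) \<Rightarrow> real set" where
  "periodic_averages f =
    {birkhoff_sum q f y / real q | q y. y \<in> X \<and> 0 < q \<and> (shift ^^ q) y = y}"

lemma periodic_averages_nonempty:
  assumes "f \<in> C0 lam X" shows "periodic_averages f \<noteq> {}"
proof -
  obtain x where "x \<in> X" using nonempty by blast
  moreover obtain C where "\<And>x n. x \<in> X \<Longrightarrow> 0 < n \<Longrightarrow> \<exists>y\<in>X. \<exists>q. n \<le> q \<and> real q \<le> real n + C \<and>
      (shift ^^ q) y = y \<and> \<bar>birkhoff_sum q f y - birkhoff_sum n f x\<bar> \<le> real n * 1 + C"
    using orbit_closing[OF assms, of 1] by (metis zero_less_one)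
  ultimately obtain y q where "y \<in> X" "1 \<le> q" "(shift ^^ q) y = y"
    by (meson zero_less_one)
  then have "0 < q" by simp
  with \<open>y \<in> X\<close> \<open>(shift ^^ q) y = y\<close> show ?thesis unfolding periodic_averages_def by blast
qed

lemma periodic_averages_bdd_below:
  assumes "f \<in> C0 lam X" shows "bdd_below (periodic_averages f)"
proof -
  obtain G where G: "\<And>x. x \<in> X \<Longrightarrow> \<bar>f x\<bar> \<le> G" using C0_bounded[OF assms] by blast
  show ?thesis
  proof (rule bdd_belowI)
    fix a assume "a \<in> periodic_averages f"
    then obtain q y where a: "a = birkhoff_sum q f y / real q" "y \<in> X" "0 < q"
      unfolding periodic_averages_def by blast
    have "\<bar>birkhoff_sum q f y\<bar> \<le> real q * G" by (rule birkhoff_sum_bound[OF G a(2)])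
    then have "- G * real q \<le> birkhoff_sum q f y" by (simp add: mult.commute)
    then have "- G * real q \<le> a * real q" using a(1,3) by simp
    then show "-G \<le> a" by (rule mult_right_le_imp_le) (use a(3) in simp)
  qed
qed

text \<open>The shadowing periodic orbit of period \<open>q\<close> has Birkhoff sum at least \<open>q\<close> times the infimum, and
  \<open>q\<close> differs from \<open>n\<close> by a bounded amount only.\<close>

lemma birkhoff_sum_lower_bound:
  assumes f: "f \<in> C0 lam X" and e: "0 < e"
  obtains C where "\<And>x n. x \<in> X \<Longrightarrow> 0 < n \<Longrightarrow>
    birkhoff_sum n f x \<ge> real n * (Inf (periodic_averages f) - e) - C"
proof -
  define a where "a = Inf (periodic_averages f)"
  obtain C where C: "\<And>x n. x \<in> X \<Longrightarrow> 0 < n \<Longrightarrow> \<exists>y\<in>X. \<exists>q. n \<le> q \<and> real q \<le> real n + C \<and>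
      (shift ^^ q) y = y \<and> \<bar>birkhoff_sum q f y - birkhoff_sum n f x\<bar> \<le> real n * e + C"
    using orbit_closing[OF assms] by blast
  show thesis
  proof (rule that[of "C + C * \<bar>a\<bar>"])
    fix x n assume "x \<in> X" "0 < (n::nat)"
    then obtain y q where y: "y \<in> X" "n \<le> q" "real q \<le> real n + C" "(shift ^^ q) y = y"
        "\<bar>birkhoff_sum q f y - birkhoff_sum n f x\<bar> \<le> real n * e + C"
      using C by blast
    have "birkhoff_sum q f y / real q \<in> periodic_averages f"
      unfolding periodic_averages_def using y \<open>0 < n\<close> by fastforce
    then have "a \<le> birkhoff_sum q f y / real q"
      unfolding a_def using periodic_averages_bdd_below[OF f] by (intro cInf_lower)
    then have "real q * a \<le> birkhoff_sum q f y"
      using y(2) \<open>0 < n\<close> by (simp add: field_simps)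
    moreover have "real q * a \<ge> real n * a - C * \<bar>a\<bar>"
    proof -
      have "(real n - real q) * a \<le> \<bar>real n - real q\<bar> * \<bar>a\<bar>"
        by (metis abs_ge_self abs_mult)
      also have "\<dots> \<le> C * \<bar>a\<bar>" using y(2,3) by (intro mult_right_mono) auto
      finally show ?thesis by (simp add: algebra_simps)
    qed
    ultimately show "birkhoff_sum n f x \<ge> real n * (Inf (periodic_averages f) - e) - (C + C * \<bar>a\<bar>)"
      using y(5) unfolding a_def[symmetric] by (simp add: algebra_simps)
  qed
qed

section \<open>Coboundaries\<close>

text \<open>A discrete version of the Livsic theorem. Let \<open>\<psi> = \<phi> - k\<close> and fix the prefix of \<open>u\<close> as a base
  point. The transfer function \<open>f x\<close> is the sum of \<open>\<psi>\<close> along a path from this prefix to the prefix of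
  \<open>x\<close>. Completing two such paths by the same return path yields loops of sum zero, so \<open>f x\<close> does
  not depend on the path; and prolonging a path by one step adds \<open>\<psi> x\<close>.\<close>

lemma cohomologous_constant_if_return_averages_equal:
  assumes det: "determined_by m X \<phi>" and m: "memory m" and u: "u \<in> X"
    and ret: "\<And>w n. w \<in> X \<Longrightarrow> agree m w u \<Longrightarrow> agree m ((shift ^^ n) w) u \<Longrightarrow>
      birkhoff_sum n \<phi> w = real n * k"
  shows "cohomologous lam X \<phi> (\<lambda>_. k)"
proof -
  define \<psi> where "\<psi> x = \<phi> x - k" for x
  have S\<psi>: "birkhoff_sum n \<psi> x = birkhoff_sum n \<phi> x - real n * k" for n x
    by (simp add: birkhoff_sum_def \<psi>_def sum_subtractf)
  have det\<psi>: "determined_by m X \<psi>" 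
    unfolding determined_by_def \<psi>_def using det[unfolded determined_by_def] by metis
  define path where "path x y n \<longleftrightarrow> y \<in> X \<and> agree m y u \<and> agree m ((shift ^^ n) y) x" for x y n
  define f where "f x = (SOME t. \<exists>y n. path x y n \<and> t = birkhoff_sum n \<psi> y)" for x
  have indep: "f x = birkhoff_sum n \<psi> y" if x: "x \<in> X" and p: "path x y n" for x y n
  proof -
    obtain z p where z: "z \<in> X" "agree m x z" "agree m u ((shift ^^ p) z)"
      using connecting_point[OF x u] by blast
    have *: "birkhoff_sum n \<psi> y = - birkhoff_sum p \<psi> z" if p: "path x y n" for y n
    proof -
      have y: "y \<in> X" and yu: "agree m y u" and yz: "agree m ((shift ^^ n) y) z"
        using p z(2) by (auto simp: path_def intro: agree_trans)
      define w where "w = glue n y z"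
      have w: "w \<in> X" unfolding w_def by (rule glue_in_X[OF m y z(1) yz])
      have wy: "agree (n + m) w y" unfolding w_def by (rule agree_glue[OF yz])
      have sw: "(shift ^^ n) w = z" by (simp add: w_def funpow_shift_glue)
      then have "(shift ^^ (n + p)) w = (shift ^^ p) z"
        using funpow_shift_add[of p n w] by (simp add: add.commute)
      then have "birkhoff_sum (n + p) \<phi> w = real (n + p) * k"
        using ret[OF w, of "n + p"] agree_mono[OF wy, of m] yu z(3)
        by (auto intro: agree_trans agree_sym)
      then have "birkhoff_sum (n + p) \<psi> w = 0" by (simp add: S\<psi>)
      then have "birkhoff_sum n \<psi> w + birkhoff_sum p \<psi> z = 0"
        by (simp add: birkhoff_sum_add sw)
      moreover have "birkhoff_sum n \<psi> w = birkhoff_sum n \<psi> y"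
        by (rule birkhoff_sum_eq[OF det\<psi> w y wy])
      ultimately show ?thesis by simp
    qed
    have "\<exists>y n. path x y n \<and> f x = birkhoff_sum n \<psi> y"
      unfolding f_def by (rule someI_ex) (use p in blast)
    then show ?thesis using * p by metis
  qed
  have path_exists: "\<exists>y n. path x y n" if x: "x \<in> X" for x
    proof -
    obtain z p where "z \<in> X" "agree m u z" "agree m x ((shift ^^ p) z)"
      using connecting_point[OF u x] by blast
    then show ?thesis unfolding path_def using agree_sym by blast
  qed
  have "f \<in> C0 lam X"
    unfolding C0_iff
  proof (intro ballI allI impI)
    fix x and e :: real assume x: "x \<in> X" and "0 < e"
    have "f x = f y" if y: "y \<in> X" "agree m x y" for y
    proof -
      obtain z n where z: "path x z n" using path_exists[OF x] by blast
      then have "path y z n" using y(2) unfolding path_def using agree_trans by blast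
      then show ?thesis using indep x y z by metis
    qed
    then show "\<exists>N. \<forall>y\<in>X. agree N x y \<longrightarrow> \<bar>f x - f y\<bar> < e"
      using \<open>0 < e\<close> by (intro exI[of _ m]) simp
  qed
  moreover have "\<phi> x - k = f (shift x) - f x" if x: "x \<in> X" for x
  proof -
    obtain y n where p: "path x y n" using path_exists[OF x] by blast
    then have y: "y \<in> X" "agree m y u" and yx: "agree m ((shift ^^ n) y) x"
      by (auto simp: path_def)
    define w where "w = glue n y x"
    have w: "w \<in> X" unfolding w_def by (rule glue_in_X[OF m y(1) x yx])
    have wy: "agree (n + m) w y" unfolding w_def by (rule agree_glue[OF yx])
    have sw: "(shift ^^ n) w = x" by (simp add: w_def funpow_shift_glue)
    have "path (shift x) w (Suc n)"
      unfolding path_def using w sw agree_mono[OF wy, of m] y(2) by (auto intro: agree_trans)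
    then have "f (shift x) = birkhoff_sum (n + 1) \<psi> w"
      using indep[OF shift_in_X[OF x]] by simp
    also have "\<dots> = birkhoff_sum n \<psi> w + \<psi> x"
      unfolding birkhoff_sum_add sw by (simp add: birkhoff_sum_def)
    also have "birkhoff_sum n \<psi> w = birkhoff_sum n \<psi> y"
      by (rule birkhoff_sum_eq[OF det\<psi> w y(1) wy])
    also have "\<dots> = f x" using indep[OF x p] by simp
    finally show ?thesis by (simp add: \<psi>_def)
  qed
  ultimately show ?thesis unfolding cohomologous_def by blast
qed

end

section \<open>Invariant measures\<close>

context sequence_space begin

lemma Int_stable_clopens: "Int_stable clopens"
proof -
  interpret algebra X clopens by (rule algebra_clopens)
  show ?thesis by (auto simp: Int_stable_def)
qed

lemma clopens_subset_Pow: "clopens \<subseteq> Pow X"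
  by (auto simp: clopens_def clopen_def)

lemma X_clopens: "X \<in> clopens"
  by (auto simp: clopens_def clopen_def)

lemma measure_eq_if_eq_on_clopens:
  assumes "finite_measure \<mu>" "sets \<mu> = sets SB" "sets \<nu> = sets SB"
    and "\<And>B. B \<in> clopens \<Longrightarrow> emeasure \<mu> B = emeasure \<nu> B"
  shows "\<mu> = \<nu>"
proof (rule measure_eqI_generator_eq[of clopens X \<mu> \<nu> "\<lambda>_. X"])
  show "Int_stable clopens" "clopens \<subseteq> Pow X"
    by (rule Int_stable_clopens clopens_subset_Pow)+
  show "emeasure \<mu> B = emeasure \<nu> B" if "B \<in> clopens" for B
    using that by (rule assms)
  show "sets \<mu> = sigma_sets X clopens" "sets \<nu> = sigma_sets X clopens"
    using assms(2,3) by (simp_all add: sets_SB_clopens)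
  show "range (\<lambda>_ :: nat. X) \<subseteq> clopens" "(\<Union>i :: nat. X) = X" using X_clopens by auto
  show "emeasure \<mu> X \<noteq> \<infinity>" for i :: nat
    using finite_measure.emeasure_finite[OF assms(1)] by simp
qed

lemma bounded_borel_integrable:
  fixes f :: "(nat \<Rightarrow> 'a) \<Rightarrow> real"
  assumes "prob_space \<mu>" "sets \<mu> = sets SB" "f \<in> borel_measurable SB"
    and "\<And>x. x \<in> X \<Longrightarrow> \<bar>f x\<bar> \<le> G"
  shows "integrable \<mu> f"
proof -
  interpret prob_space \<mu> by fact
  have "space \<mu> = X" using sets_eq_imp_space_eq[OF assms(2)] by simp
  moreover have "f \<in> borel_measurable \<mu>" using assms(3) measurable_cong_sets[OF assms(2) refl] by blast
  ultimately show ?thesis using assms(4)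
    by (intro integrable_const_bound[where B = G] AE_I2) simp_all
qed

lemma finite_cylinders: "finite ((\<lambda>x. {y\<in>X. agree N x y}) ` X)"
proof (rule finite_subset)
  show "(\<lambda>x. {y\<in>X. agree N x y}) ` X \<subseteq>
      (\<lambda>w. {y\<in>X. w = map y [0..<N]}) ` range (\<lambda>x :: nat \<Rightarrow> 'a. map x [0..<N])"
    unfolding agree_iff_map_eq by blast
qed (intro finite_imageI finite_prefixes)

text \<open>A function that varies by at most \<open>e\<close> on cylinders of length \<open>N\<close> is within \<open>e\<close> of a step function
  that does not depend on the measure. This reduces convergence of integrals to convergence of the
  measures of clopen sets.\<close>

lemma integral_approx_by_clopens:
  assumes f: "f \<in> borel_measurable SB" "\<And>x. x \<in> X \<Longrightarrow> \<bar>f x\<bar> \<le> G"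
    and osc: "oscillation_below N e X f"
  obtains I v where "finite I" "I \<subseteq> clopens"
    "\<And>\<mu>. prob_space \<mu> \<Longrightarrow> sets \<mu> = sets SB \<Longrightarrow>
      \<bar>(\<integral>x. f x \<partial>\<mu>) - (\<Sum>B\<in>I. v B * measure \<mu> B)\<bar> \<le> e"
proof (rule that)
  define cyl where "cyl x = {y\<in>X. agree N x y}" for x
  define I where "I = cyl ` X"
  define v where "v B = f (SOME x. x \<in> B)" for B
  show fin: "finite I" unfolding I_def cyl_def by (rule finite_cylinders)
  show I: "I \<subseteq> clopens" unfolding I_def cyl_def using cylinder_clopens by blast
  define s where "s x = (\<Sum>B\<in>I. v B * indicator B x)" for x
  have close: "\<bar>f x - s x\<bar> \<le> e" if x: "x \<in> X" for x
  proof -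
    have "cyl x \<in> I" "x \<in> cyl x" using x by (auto simp: I_def cyl_def)
    have uniq: "B = cyl x" if B: "B \<in> I" "x \<in> B" for B
    proof -
      obtain x' where "B = cyl x'" using B(1) unfolding I_def by blast
      then show ?thesis using B(2) unfolding cyl_def agree_iff_map_eq by simp
    qed
    have "v B * indicator B x = (if B = cyl x then v (cyl x) else 0)" if B: "B \<in> I" for B
    proof (cases "B = cyl x")
      case False
      then have "x \<notin> B" using uniq[OF B] by blast
      then show ?thesis using False by simp
    qed (use \<open>x \<in> cyl x\<close> in simp)
    then have "s x = (\<Sum>B\<in>I. if B = cyl x then v (cyl x) else 0)"
      unfolding s_def by (rule sum.cong[OF refl])
    then have s: "s x = v (cyl x)" using fin \<open>cyl x \<in> I\<close> by simp
    have "(SOME y. y \<in> cyl x) \<in> cyl x" 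
      using someI[of "\<lambda>y. y \<in> cyl x" x] \<open>x \<in> cyl x\<close> by simp
    then show ?thesis
      using osc x unfolding s v_def oscillation_below_def cyl_def by blast
  qed
  fix \<mu> assume \<mu>: "prob_space \<mu>" "sets \<mu> = sets SB"
  interpret prob_space \<mu> by fact
  have space: "space \<mu> = X" using sets_eq_imp_space_eq[OF \<mu>(2)] by simp
  have sets: "B \<in> sets \<mu>" if "B \<in> I" for B
    using that I clopens_sets_SB \<mu>(2) by auto
  have int_f: "integrable \<mu> f" using bounded_borel_integrable[OF \<mu> f] by blast
  have int_ind: "integrable \<mu> (\<lambda>x. v B * indicator B x)" if "B \<in> I" for B
    using sets[OF that] by (simp add: emeasure_eq_measure)
  have int_s: "integrable \<mu> s" unfolding s_def using int_ind by (rule Bochner_Integration.integrable_sum)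
  have "(\<integral>x. s x \<partial>\<mu>) = (\<Sum>B\<in>I. \<integral>x. v B * indicator B x \<partial>\<mu>)"
    unfolding s_def using int_ind by (rule Bochner_Integration.integral_sum)
  also have "\<dots> = (\<Sum>B\<in>I. v B * measure \<mu> B)"
  proof (rule sum.cong)
    fix B assume "B \<in> I"
    then have "B \<inter> space \<mu> = B" using sets sets.sets_into_space by blast
    then show "(\<integral>x. v B * indicator B x \<partial>\<mu>) = v B * measure \<mu> B" by simp
  qed simp
  finally have "(\<integral>x. f x \<partial>\<mu>) - (\<Sum>B\<in>I. v B * measure \<mu> B) = (\<integral>x. f x - s x \<partial>\<mu>)"
    using int_f int_s by simp
  also have "\<bar>\<dots>\<bar> \<le> (\<integral>x. \<bar>f x - s x\<bar> \<partial>\<mu>)" by (rule integral_abs_bound)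
  also have "\<dots> \<le> e"
    using int_f int_s close by (intro integral_le_const AE_I2) (simp_all add: space)
  finally show "\<bar>(\<integral>x. f x \<partial>\<mu>) - (\<Sum>B\<in>I. v B * measure \<mu> B)\<bar> \<le> e" .
qed

end

context sft begin

abbreviation invariant :: "(nat \<Rightarrow> 'a) measure \<Rightarrow> bool" where
  "invariant \<mu> \<equiv> \<mu> \<in> invariant_measures lam X"

lemma invariantD:
  assumes "invariant \<mu>"
  shows "prob_space \<mu>" "sets \<mu> = sets SB" "distr \<mu> \<mu> shift = \<mu>" "space \<mu> = X"
  using assms sets_eq_imp_space_eq[of \<mu> SB] by (auto simp: invariant_measures_def)

lemma shift_vimage_clopens:
  assumes "B \<in> clopens" shows "shift -` B \<inter> X \<in> clopens"
proof -
  obtain N where "clopen N B" using assms by (auto simp: clopens_def)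
  then have "clopen (Suc N) (shift -` B \<inter> X)"
    unfolding clopen_def using agree_shift shift_in_X by blast
  then show ?thesis by (auto simp: clopens_def)
qed

lemma shift_measurable: "shift \<in> measurable SB SB"
proof -
  have "shift \<in> measurable SB (sigma X clopens)"
    by (rule measurable_measure_of)
      (use clopens_subset_Pow shift_in_X shift_vimage_clopens clopens_sets_SB in auto)
  moreover have "sets (sigma X clopens) = sets SB"
    using clopens_subset_Pow by (simp add: sets_SB_clopens)
  ultimately show ?thesis using measurable_cong_sets by blast
qed

lemma funpow_shift_measurable: "shift ^^ j \<in> measurable SB SB"
proof (induction j)
  case (Suc j)
  then show ?case unfolding funpow.simps by (rule measurable_comp[OF _ shift_measurable])
qed (simp add: id_def)

text \<open>The clopen sets form an intersection-stable generator, so invariance need only be tested on them.\<close>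

lemma invariantI:
  assumes "prob_space \<mu>" "sets \<mu> = sets SB"
    and "\<And>B. B \<in> clopens \<Longrightarrow> measure \<mu> (shift -` B \<inter> X) = measure \<mu> B"
  shows "invariant \<mu>"
proof -
  interpret prob_space \<mu> by fact
  have sp: "space \<mu> = X" using sets_eq_imp_space_eq[OF assms(2)] by simp
  have m: "shift \<in> measurable \<mu> \<mu>"
    using shift_measurable measurable_cong_sets[OF assms(2) assms(2)] by blast
  have "distr \<mu> \<mu> shift = \<mu>"
  proof (rule measure_eq_if_eq_on_clopens)
    show "finite_measure (distr \<mu> \<mu> shift)" using m by (rule finite_measure_distr)
    fix B assume B: "B \<in> clopens"
    then have "emeasure (distr \<mu> \<mu> shift) B = emeasure \<mu> (shift -` B \<inter> X)"
      using emeasure_distr[OF m, of B] assms(2) clopens_sets_SB sp by simp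
    then show "emeasure (distr \<mu> \<mu> shift) B = emeasure \<mu> B"
      using assms(3)[OF B] by (simp add: emeasure_eq_measure)
  qed (use assms(2) in auto)
  then show ?thesis using assms(1,2) by (simp add: invariant_measures_def)
qed

lemma invariant_measure_vimage:
  assumes "invariant \<mu>" "B \<in> sets SB"
  shows "measure \<mu> (shift -` B \<inter> X) = measure \<mu> B"
proof -
  note i = invariantD[OF assms(1)]
  have m: "shift \<in> measurable \<mu> \<mu>"
    using shift_measurable measurable_cong_sets[OF i(2) i(2)] by blast
  have "measure \<mu> B = measure (distr \<mu> \<mu> shift) B" using i(3) by simp
  also have "\<dots> = measure \<mu> (shift -` B \<inter> X)"
    using measure_distr[OF m, of B] assms(2) i(2,4) by simp
  finally show ?thesis by simp
qed

lemma C0_integrable: "invariant \<mu> \<Longrightarrow> f \<in> C0 lam X \<Longrightarrow> integrable \<mu> f"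
  using C0_bounded[of f] bounded_borel_integrable[OF invariantD(1,2) C0_measurable, of \<mu> f] by metis

lemma integral_birkhoff_sum:
  assumes \<mu>: "invariant \<mu>" and f: "f \<in> C0 lam X"
  shows "integrable \<mu> (birkhoff_sum n f)"
    and "(\<integral>x. birkhoff_sum n f x \<partial>\<mu>) = real n * (\<integral>x. f x \<partial>\<mu>)"
proof -
  note i = invariantD[OF \<mu>]
  obtain G where G: "\<And>x. x \<in> X \<Longrightarrow> \<bar>f x\<bar> \<le> G" using C0_bounded[OF f] by blast
  have meas: "(\<lambda>x. f ((shift ^^ j) x)) \<in> borel_measurable SB" for j
    using measurable_compose[OF funpow_shift_measurable C0_measurable[OF f]] .
  have int: "integrable \<mu> (\<lambda>x. f ((shift ^^ j) x))" for j
    using bounded_borel_integrable[OF i(1,2) meas] G funpow_shift_in_X by blast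
  have m: "shift \<in> measurable \<mu> \<mu>"
    using shift_measurable measurable_cong_sets[OF i(2) i(2)] by blast
  have eq: "(\<integral>x. f ((shift ^^ j) x) \<partial>\<mu>) = (\<integral>x. f x \<partial>\<mu>)" for j
  proof (induction j)
    case (Suc j)
    have "(\<integral>x. f ((shift ^^ Suc j) x) \<partial>\<mu>) = (\<integral>x. f ((shift ^^ j) (shift x)) \<partial>\<mu>)"
      by (simp only: funpow_Suc_right comp_def)
    also have "\<dots> = (\<integral>x. f ((shift ^^ j) x) \<partial>distr \<mu> \<mu> shift)"
      using meas[of j] i(2) by (intro integral_distr[OF m, symmetric]) (simp cong: measurable_cong_sets)
    also have "\<dots> = (\<integral>x. f x \<partial>\<mu>)" using Suc i(3) by simp
    finally show ?case .
  qed simp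
  show "integrable \<mu> (birkhoff_sum n f)"
    unfolding birkhoff_sum_def[abs_def] using int by simp
  show "(\<integral>x. birkhoff_sum n f x \<partial>\<mu>) = real n * (\<integral>x. f x \<partial>\<mu>)"
    unfolding birkhoff_sum_def using int eq by (simp add: Bochner_Integration.integral_sum)
qed

text \<open>A diagonal argument makes the measures of all the countably many clopen sets converge. The limit
  is additive, and it is continuous at the empty set for a trivial reason: by compactness a
  decreasing sequence of clopen sets with empty intersection is eventually empty. Caratheodory's
  theorem extends it to a measure.\<close>

lemma invariant_measures_seq_compact:
  assumes \<mu>: "\<And>n :: nat. invariant (\<mu> n)"
  obtains k \<nu> where "strict_mono (k :: nat \<Rightarrow> nat)" "invariant \<nu>"
    "\<And>f. f \<in> C0 lam X \<Longrightarrow> (\<lambda>n. \<integral>x. f x \<partial>\<mu> (k n)) \<longlonglongrightarrow> (\<integral>x. f x \<partial>\<nu>)"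
proof -
  interpret A: algebra X clopens by (rule algebra_clopens)
  note i = invariantD[OF \<mu>]
  have le1: "norm (measure (\<mu> n) B) \<le> 1" for n B
    using prob_space.prob_le_1[OF i(1)] by simp
  obtain k where k: "strict_mono (k :: nat \<Rightarrow> nat)"
      and lim: "\<And>B. B \<in> clopens \<Longrightarrow> \<exists>l. (\<lambda>n. measure (\<mu> (k n)) B) \<longlonglongrightarrow> l"
    by (rule function_convergent_subsequence[of clopens "\<lambda>n. measure (\<mu> n)" 1])
      (use countable_clopens le1 in simp_all)
  define L where "L B = lim (\<lambda>n. measure (\<mu> (k n)) B)" for B
  have L: "(\<lambda>n. measure (\<mu> (k n)) B) \<longlonglongrightarrow> L B" if "B \<in> clopens" for B
    using lim[OF that] unfolding L_def by (simp add: convergent_def convergent_LIMSEQ_iff[symmetric])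
  have L_eq: "L B = l" if "B \<in> clopens" "(\<lambda>n. measure (\<mu> (k n)) B) \<longlonglongrightarrow> l" for B l
    using LIMSEQ_unique[OF L[OF that(1)] that(2)] .
  have L_nonneg: "0 \<le> L B" if "B \<in> clopens" for B
    using LIMSEQ_le_const[OF L[OF that]] by auto
  have L_empty: "L {} = 0" by (rule L_eq) auto
  have L_X: "L X = 1"
  proof (rule L_eq)
    have "measure (\<mu> n) X = 1" for n
      using prob_space.prob_space[OF i(1)[of n]] i(4)[of n] by simp
    then show "(\<lambda>n. measure (\<mu> (k n)) X) \<longlonglongrightarrow> 1" by simp
  qed (rule X_clopens)
  have L_Un: "L (B \<union> C) = L B + L C" if BC: "B \<in> clopens" "C \<in> clopens" "B \<inter> C = {}" for B C
  proof (rule L_eq)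
    have "measure (\<mu> n) (B \<union> C) = measure (\<mu> n) B + measure (\<mu> n) C" for n
    proof -
      interpret prob_space "\<mu> n" by (rule i)
      show ?thesis using BC clopens_sets_SB i(2) by (intro finite_measure_Union) auto
    qed
    then show "(\<lambda>n. measure (\<mu> (k n)) (B \<union> C)) \<longlonglongrightarrow> L B + L C"
      using tendsto_add[OF L[OF BC(1)] L[OF BC(2)]] by simp
  qed (use BC in auto)
  have "\<exists>m :: (nat \<Rightarrow> 'a) set \<Rightarrow> ennreal. (\<forall>B\<in>clopens. m B = ennreal (L B)) \<and>
      measure_space X (sigma_sets X clopens) m"
  proof (rule A.caratheodory_empty_continuous)
    show "positive clopens (\<lambda>B. ennreal (L B))" by (simp add: positive_def L_empty)
    show "additive clopens (\<lambda>B. ennreal (L B))"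
      unfolding additive_def by (auto simp: L_Un ennreal_plus L_nonneg)
    fix B :: "nat \<Rightarrow> (nat \<Rightarrow> 'a) set"
    assume B: "range B \<subseteq> clopens" "decseq B" "(\<Inter>i. B i) = {}"
    have "\<exists>n. B n = {}"
    proof (rule ccontr)
      assume "\<nexists>n. B n = {}"
      then have "\<forall>n. \<exists>z. z \<in> B n" by blast
      then obtain x where x: "\<And>n. x n \<in> B n" by metis
      have BX: "B n \<subseteq> X" for n using B(1) clopens_subset_Pow by blast
      then obtain r y where r: "strict_mono (r :: nat \<Rightarrow> nat)" "y \<in> X"
          "\<And>N. eventually (\<lambda>n. agree N (x (r n)) y) sequentially"
        using X_seq_compact[of x] x by blast
      have "y \<in> B n" for n
      proof -
        obtain N where N: "clopen N (B n)" using B(1) by (auto simp: clopens_def)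
        have "eventually (\<lambda>j. agree N (x (r j)) y \<and> n \<le> j) sequentially"
          using r(3) eventually_ge_at_top by (rule eventually_conj)
        then obtain j where j: "agree N (x (r j)) y" "n \<le> j"
          using eventually_happens'[OF sequentially_bot] by blast
        have "n \<le> r j" using j(2) seq_suble[OF r(1)] order_trans by blast
        then have "x (r j) \<in> B n" using x[of "r j"] B(2) unfolding decseq_def by blast
        then show ?thesis using N j(1) r(2) unfolding clopen_def by blast
      qed
      then show False using B(3) by blast
    qed
    then obtain n where n: "B n = {}" ..
    have "ennreal (L (B j)) = 0" if "n \<le> j" for j
    proof -
      have "B j = {}" using B(2) n that unfolding decseq_def by blast
      then show ?thesis by (simp add: L_empty)
    qed
    then have "eventually (\<lambda>j. ennreal (L (B j)) = 0) sequentially"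
      unfolding eventually_sequentially by blast
    then show "(\<lambda>j. ennreal (L (B j))) \<longlonglongrightarrow> 0" by (rule tendsto_eventually)
  qed simp
  then obtain m :: "(nat \<Rightarrow> 'a) set \<Rightarrow> ennreal" where
      m: "\<And>B. B \<in> clopens \<Longrightarrow> m B = ennreal (L B)" "measure_space X (sigma_sets X clopens) m"
    by blast
  define \<nu> where "\<nu> = measure_of X clopens m"
  have sets_\<nu>: "sets \<nu> = sets SB"
    unfolding \<nu>_def sets_SB_clopens using clopens_subset_Pow by (rule sets_measure_of)
  have space_\<nu>: "space \<nu> = X" using sets_eq_imp_space_eq[OF sets_\<nu>] by simp
  have em: "emeasure \<nu> B = ennreal (L B)" if "B \<in> clopens" for B
  proof -
    have "emeasure \<nu> B = m B"
      unfolding \<nu>_def using m(2) clopens_subset_Pow that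
      by (subst emeasure_measure_of_conv) auto
    then show ?thesis using m(1)[OF that] by simp
  qed
  then have ms: "measure \<nu> B = L B" if "B \<in> clopens" for B
    using that L_nonneg[OF that] by (simp add: measure_def)
  have prob: "prob_space \<nu>"
    by (rule prob_spaceI) (simp add: space_\<nu> em[OF X_clopens] L_X)
  have inv: "invariant \<nu>"
  proof (rule invariantI[OF prob sets_\<nu>])
    fix B assume B: "B \<in> clopens"
    have "L (shift -` B \<inter> X) = L B"
      using L[OF B] by (intro L_eq shift_vimage_clopens B)
        (simp add: invariant_measure_vimage[OF \<mu> clopens_sets_SB[OF B]])
    then show "measure \<nu> (shift -` B \<inter> X) = measure \<nu> B"
      using ms B shift_vimage_clopens by simp
  qed
  have "(\<lambda>n. \<integral>x. f x \<partial>\<mu> (k n)) \<longlonglongrightarrow> (\<integral>x. f x \<partial>\<nu>)" if f: "f \<in> C0 lam X" for f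
  proof (rule LIMSEQ_I)
    fix e :: real assume "0 < e"
    then have "0 < e / 3" by simp
    obtain N where N: "oscillation_below N (e/3) X f" using C0_oscillation[OF f \<open>0 < e/3\<close>] .
    obtain G where G: "\<And>x. x \<in> X \<Longrightarrow> \<bar>f x\<bar> \<le> G" using C0_bounded[OF f] by blast
    obtain I v where I: "finite I" "I \<subseteq> clopens" and
      v: "\<And>\<mu>. prob_space \<mu> \<Longrightarrow> sets \<mu> = sets SB \<Longrightarrow>
        \<bar>(\<integral>x. f x \<partial>\<mu>) - (\<Sum>B\<in>I. v B * measure \<mu> B)\<bar> \<le> e/3"
      using integral_approx_by_clopens[OF C0_measurable[OF f] G N] by blast
    have "(\<lambda>n. \<Sum>B\<in>I. v B * measure (\<mu> (k n)) B) \<longlonglongrightarrow> (\<Sum>B\<in>I. v B * measure \<nu> B)"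
      using L I(2) ms by (intro tendsto_sum tendsto_mult_left) auto
    then obtain n0 where n0: "\<And>n. n \<ge> n0 \<Longrightarrow>
        \<bar>(\<Sum>B\<in>I. v B * measure (\<mu> (k n)) B) - (\<Sum>B\<in>I. v B * measure \<nu> B)\<bar> < e/3"
      using LIMSEQ_D[OF _ \<open>0 < e/3\<close>, of "\<lambda>n. \<Sum>B\<in>I. v B * measure (\<mu> (k n)) B"]
      by (auto simp only: real_norm_def)
    have "norm ((\<integral>x. f x \<partial>\<mu> (k n)) - (\<integral>x. f x \<partial>\<nu>)) < e" if "n \<ge> n0" for n
      using n0[OF that] v[OF prob sets_\<nu>] v[OF i(1,2)[of "k n"]] unfolding real_norm_def by linarith
    then show "\<exists>n0. \<forall>n\<ge>n0. norm ((\<integral>x. f x \<partial>\<mu> (k n)) - (\<integral>x. f x \<partial>\<nu>)) < e" by blast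
  qed
  then show thesis by (rule that[OF k inv])
qed

text \<open>The mixture is realised by choosing between the two measures according to a Bernoulli trial.\<close>

lemma invariant_measures_convex:
  assumes \<mu>: "invariant \<mu>" and \<nu>: "invariant \<nu>" and t: "0 \<le> t" "t \<le> 1"
  obtains \<rho> where "invariant \<rho>"
    "\<And>f. f \<in> C0 lam X \<Longrightarrow> (\<integral>x. f x \<partial>\<rho>) = t * (\<integral>x. f x \<partial>\<mu>) + (1 - t) * (\<integral>x. f x \<partial>\<nu>)"
proof -
  note i = invariantD[OF \<mu>] and j = invariantD[OF \<nu>]
  define K where "K b = (if b then \<mu> else \<nu>)" for b
  have K_inv: "invariant (K b)" for b using \<mu> \<nu> by (simp add: K_def)
  note K = invariantD[OF K_inv]
  have K_meas: "K \<in> measurable (measure_pmf (bernoulli_pmf t)) (subprob_algebra SB)"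
    using K(1,2) by (auto simp: space_subprob_algebra intro: prob_space_imp_subprob_space)
  define \<rho> where "\<rho> = measure_pmf (bernoulli_pmf t) \<bind> K"
  have sets_\<rho>: "sets \<rho> = sets SB"
    unfolding \<rho>_def by (rule sets_bind[OF K(2)]) simp
  have integral: "(\<integral>x. f x \<partial>\<rho>) = t * (\<integral>x. f x \<partial>\<mu>) + (1 - t) * (\<integral>x. f x \<partial>\<nu>)"
    if f: "f \<in> borel_measurable SB" "\<And>x. x \<in> X \<Longrightarrow> \<bar>f x\<bar> \<le> G" for f G
  proof -
    have "(\<integral>x. f x \<partial>\<rho>) = (\<integral>b. \<integral>x. f x \<partial>K b \<partial>measure_pmf (bernoulli_pmf t))"
      unfolding \<rho>_def
    proof (rule integral_bind[OF f(1) _ K_meas, where B = G and B' = 1])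
      show "\<bar>f x\<bar> \<le> G" if "x \<in> space SB" for x using f(2) that by simp
      show "AE b in measure_pmf (bernoulli_pmf t). emeasure (K b) (space (K b)) \<le> ennreal 1"
        using prob_space.emeasure_space_1[OF K(1)] by simp
    qed (rule measure_pmf.finite_measure_axioms)
    then show ?thesis using t by (simp add: K_def mult.commute)
  qed
  have prob: "prob_space \<rho>"
    unfolding \<rho>_def
    by (rule prob_space.prob_space_bind[OF _ _ K_meas])
      (use K(1) measure_pmf.prob_space_axioms in auto)
  have measure: "measure \<rho> B = t * measure \<mu> B + (1 - t) * measure \<nu> B" if B: "B \<in> sets SB" for B
  proof -
    have "measure \<tau> B = (\<integral>x. indicator B x \<partial>\<tau>)" if "sets \<tau> = sets SB" for \<tau> :: "(nat \<Rightarrow> 'a) measure"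
    proof -
      have "B \<inter> space \<tau> = B" using B that sets.sets_into_space by blast
      then show ?thesis by simp
    qed
    moreover have "(\<integral>x. indicator B x \<partial>\<rho>) =
        t * (\<integral>x. indicator B x \<partial>\<mu>) + (1 - t) * (\<integral>x. indicator B x \<partial>\<nu>)"
      using B by (intro integral[of _ 1]) (auto simp: indicator_def)
    ultimately show ?thesis using i(2) j(2) sets_\<rho> by simp
  qed
  have "invariant \<rho>"
  proof (rule invariantI[OF prob sets_\<rho>])
    fix B assume B: "B \<in> clopens"
    show "measure \<rho> (shift -` B \<inter> X) = measure \<rho> B"
      using measure[OF clopens_sets_SB] B shift_vimage_clopens[OF B]
        invariant_measure_vimage[OF \<mu> clopens_sets_SB[OF B]]
        invariant_measure_vimage[OF \<nu> clopens_sets_SB[OF B]] by simp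
  qed
  moreover have "(\<integral>x. f x \<partial>\<rho>) = t * (\<integral>x. f x \<partial>\<mu>) + (1 - t) * (\<integral>x. f x \<partial>\<nu>)"
    if f: "f \<in> C0 lam X" for f
    using C0_bounded[OF f] integral[OF C0_measurable[OF f]] by metis
  ultimately show thesis by (rule that)
qed

section \<open>Periodic orbit measures\<close>

text \<open>Defined as the distribution of a point at a uniformly chosen time, so that integrals become
  Birkhoff averages.\<close>

definition orbit_measure :: "nat \<Rightarrow> (nat \<Rightarrow> 'a) \<Rightarrow> (nat \<Rightarrow> 'a) measure" where
  "orbit_measure q y = distr (measure_pmf (pmf_of_set {..<q})) SB (\<lambda>j. (shift ^^ j) y)"

lemma sets_orbit_measure [simp]: "sets (orbit_measure q y) = sets SB"
  by (simp add: orbit_measure_def)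

lemma orbit_map_measurable:
  "y \<in> X \<Longrightarrow> (\<lambda>j. (shift ^^ j) y) \<in> measurable (measure_pmf (pmf_of_set {..<q})) SB"
  using funpow_shift_in_X by simp

lemma prob_space_orbit_measure: "y \<in> X \<Longrightarrow> prob_space (orbit_measure q y)"
  unfolding orbit_measure_def
  using measure_pmf.prob_space_distr[OF orbit_map_measurable] .

lemma integral_orbit_measure:
  assumes "y \<in> X" "0 < q" "f \<in> borel_measurable SB"
  shows "(\<integral>x. f x \<partial>orbit_measure q y) = birkhoff_sum q f y / real q"
  unfolding orbit_measure_def integral_distr[OF orbit_map_measurable[OF assms(1)] assms(3)]
  using assms(2) by (subst integral_pmf_of_set) (auto simp: birkhoff_sum_def lessThan_empty_iff)

lemma measure_orbit_measure:
  assumes "y \<in> X" "0 < q" "B \<in> sets SB"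
  shows "measure (orbit_measure q y) B = birkhoff_sum q (indicator B) y / real q"
proof -
  have "B \<inter> space (orbit_measure q y) = B"
    using assms(3) sets.sets_into_space[of B "orbit_measure q y"] by auto
  then show ?thesis
    using integral_orbit_measure[OF assms(1,2), of "indicator B"] assms(3) by simp
qed

lemma invariant_orbit_measure:
  assumes "y \<in> X" "0 < q" "(shift ^^ q) y = y"
  shows "invariant (orbit_measure q y)"
proof (rule invariantI[OF prob_space_orbit_measure[OF assms(1)] sets_orbit_measure])
  fix B assume B: "B \<in> clopens"
  define h :: "nat \<Rightarrow> real" where "h j = indicator B ((shift ^^ j) y)" for j
  have "birkhoff_sum q (indicator (shift -` B \<inter> X)) y = (\<Sum>j<q. h (Suc j))"
    unfolding birkhoff_sum_def h_def using funpow_shift_in_X[OF assms(1)]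
    by (intro sum.cong) (auto simp: indicator_def)
  also have "\<dots> = (\<Sum>j<q. h j)"
    using sum.lessThan_Suc_shift[of h q] sum.lessThan_Suc[of h q] assms(3) by (simp add: h_def)
  finally have "birkhoff_sum q (indicator (shift -` B \<inter> X)) y = birkhoff_sum q (indicator B) y"
    by (simp add: birkhoff_sum_def h_def)
  then show "measure (orbit_measure q y) (shift -` B \<inter> X) = measure (orbit_measure q y) B"
    using measure_orbit_measure[OF assms(1,2)] B clopens_sets_SB shift_vimage_clopens by simp
qed

lemma periodic_orbit_measure:
  assumes "y \<in> X" "0 < q" "(shift ^^ q) y = y"
  shows "periodic_measure lam X (orbit_measure q y)"
proof -
  interpret prob_space "orbit_measure q y" by (rule prob_space_orbit_measure[OF assms(1)])
  have "emeasure (orbit_measure q y) B =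
      ennreal (1 / real q) * (\<Sum>j<q. emeasure (return SB ((shift ^^ j) y)) B)"
    if B: "B \<in> sets SB" for B
  proof -
    have "(\<Sum>j<q. emeasure (return SB ((shift ^^ j) y)) B) =
        (\<Sum>j<q. ennreal (indicator B ((shift ^^ j) y)))"
      using B by (intro sum.cong) (auto simp: indicator_def)
    also have "\<dots> = ennreal (birkhoff_sum q (indicator B) y)"
      unfolding birkhoff_sum_def by (rule sum_ennreal) simp
    finally have "ennreal (1 / real q) * (\<Sum>j<q. emeasure (return SB ((shift ^^ j) y)) B) =
        ennreal (birkhoff_sum q (indicator B) y / real q)"
      by (simp add: ennreal_mult'[symmetric])
    then show ?thesis
      using measure_orbit_measure[OF assms(1,2) B] by (simp add: emeasure_eq_measure)
  qed
  then show ?thesis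
    unfolding periodic_measure_def using assms sets_orbit_measure by blast
qed

end

section \<open>Minimizing measures\<close>

lemma C0_linear_combination:
  assumes "\<phi> \<in> C0 lam X" "A \<in> C0 lam X"
  shows "(\<lambda>x. c * \<phi> x - A x) \<in> C0 lam X"
  using assms unfolding C0_def
  by (auto intro!: continuous_map_diff continuous_map_real_mult_left)

context transitive_sft begin

text \<open>The integral of \<open>f\<close> is that of \<open>birkhoff_sum n f\<close> divided by \<open>n\<close>. The pointwise lower bound for the
  latter contributes an error \<open>C / n\<close>, which disappears for large \<open>n\<close>.\<close>

lemma integral_ge_Inf_periodic_averages:
  assumes \<mu>: "invariant \<mu>" and f: "f \<in> C0 lam X"
  shows "Inf (periodic_averages f) \<le> (\<integral>x. f x \<partial>\<mu>)"
proof (rule field_le_epsilon)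
  fix e :: real assume "0 < e"
  then have e2: "0 < e / 2" by simp
  define a where "a = Inf (periodic_averages f)"
  interpret prob_space \<mu> by (rule invariantD[OF \<mu>])
  obtain C where C: "\<And>x n. x \<in> X \<Longrightarrow> 0 < n \<Longrightarrow> birkhoff_sum n f x \<ge> real n * (a - e/2) - C"
    using birkhoff_sum_lower_bound[OF f e2] unfolding a_def by blast
  obtain n where n: "C / (e/2) < real n" "0 < n"
  proof -
    obtain n where "C / (e/2) < real n" using reals_Archimedean2 by blast
    then show thesis by (intro that[of "Suc n"]) auto
  qed
  have "real n * (a - e/2) - C \<le> (\<integral>x. birkhoff_sum n f x \<partial>\<mu>)"
    using C[OF _ n(2)] invariantD(4)[OF \<mu>]
    by (intro integral_ge_const integral_birkhoff_sum(1)[OF \<mu> f] AE_I2) simp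
  also have "\<dots> = real n * (\<integral>x. f x \<partial>\<mu>)" by (rule integral_birkhoff_sum(2)[OF \<mu> f])
  finally have "real n * (a - e/2) - C \<le> real n * (\<integral>x. f x \<partial>\<mu>)" .
  moreover have "C < real n * (e/2)" using n(1) e2 by (simp add: pos_divide_less_eq)
  ultimately have "real n * a \<le> real n * ((\<integral>x. f x \<partial>\<mu>) + e)"
    unfolding right_diff_distrib distrib_left by linarith
  then show "Inf (periodic_averages f) \<le> (\<integral>x. f x \<partial>\<mu>) + e"
    unfolding a_def[symmetric] using n(2) by simp
qed

lemma periodic_average_near_Inf:
  assumes "f \<in> C0 lam X" "0 < e"
  obtains y q where "y \<in> X" "0 < q" "(shift ^^ q) y = y"
    "birkhoff_sum q f y / real q < Inf (periodic_averages f) + e"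
proof -
  obtain a where "a \<in> periodic_averages f" "a < Inf (periodic_averages f) + e"
    using cInf_lessD[OF periodic_averages_nonempty[OF assms(1)]] assms(2)
    by (metis less_add_same_cancel1)
  then show thesis using that unfolding periodic_averages_def by blast
qed

text \<open>A limit point of the measures on periodic orbits whose averages approach the infimum.\<close>

lemma minimizing_measure_exists:
  assumes f: "f \<in> C0 lam X"
  obtains \<mu> where "invariant \<mu>" "(\<integral>x. f x \<partial>\<mu>) = Inf (periodic_averages f)"
proof -
  define a where "a = Inf (periodic_averages f)"
  have "\<exists>\<mu>. invariant \<mu> \<and> (\<integral>x. f x \<partial>\<mu>) < a + 1 / real (Suc n)" for n
  proof -
    obtain y q where y: "y \<in> X" "0 < q" "(shift ^^ q) y = y"
        "birkhoff_sum q f y / real q < a + 1 / real (Suc n)"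
      using periodic_average_near_Inf[OF f, of "1 / real (Suc n)"] unfolding a_def by auto
    then show ?thesis
      using invariant_orbit_measure[OF y(1-3)]
        integral_orbit_measure[OF y(1,2) C0_measurable[OF f]] by metis
  qed
  then obtain \<mu> where \<mu>: "\<And>n. invariant (\<mu> n)" "\<And>n. (\<integral>x. f x \<partial>\<mu> n) < a + 1 / real (Suc n)"
    by metis
  obtain k \<nu> where k: "strict_mono k" "invariant \<nu>"
      and lim: "\<And>f. f \<in> C0 lam X \<Longrightarrow> (\<lambda>n. \<integral>x. f x \<partial>\<mu> (k n)) \<longlonglongrightarrow> (\<integral>x. f x \<partial>\<nu>)"
    by (rule invariant_measures_seq_compact[of \<mu>, OF \<mu>(1)]) (rule that)
  have "(\<lambda>n. a + 1 / real (Suc (k n))) \<longlonglongrightarrow> a + 0"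
    using LIMSEQ_subseq_LIMSEQ[OF LIMSEQ_inverse_real_of_nat k(1)]
    by (intro tendsto_intros) (simp add: comp_def inverse_eq_divide)
  then have "(\<integral>x. f x \<partial>\<nu>) \<le> a + 0"
  proof (rule LIMSEQ_le[OF lim[OF f]], intro exI[of _ 0] allI impI)
    show "(\<integral>x. f x \<partial>\<mu> (k n)) \<le> a + 1 / real (Suc (k n))" for n
      using \<mu>(2) by (rule less_imp_le)
  qed
  then have "(\<integral>x. f x \<partial>\<nu>) = a"
    using integral_ge_Inf_periodic_averages[OF k(2) f] unfolding a_def by simp
  then show thesis using that k(2) unfolding a_def by blast
qed

text \<open>Since the minimizing measure exists, the least value in the definition of \<open>alpha_fun\<close> is attained,
  at the integral of \<open>\<phi>\<close> with respect to this measure.\<close>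

lemma alpha_fun_eq_Inf_periodic_averages:
  assumes \<phi>: "\<phi> \<in> C0 lam X" and A: "A \<in> C0 lam X"
  shows "alpha_fun lam X A \<phi> c = Inf (periodic_averages (\<lambda>x. c * \<phi> x - A x))"
proof -
  define g where "g x = c * \<phi> x - A x" for x
  define a where "a = Inf (periodic_averages g)"
  have g: "g \<in> C0 lam X" using C0_linear_combination[OF \<phi> A] by (simp add: g_def[abs_def])
  have int_g: "(\<integral>x. g x \<partial>\<mu>) = c * (\<integral>x. \<phi> x \<partial>\<mu>) - (\<integral>x. A x \<partial>\<mu>)" if "invariant \<mu>" for \<mu>
    unfolding g_def using C0_integrable[OF that \<phi>] C0_integrable[OF that A] by simp
  have le: "(\<integral>x. A x \<partial>\<mu>) \<le> c * h - a" if "\<mu> \<in> integral_fiber lam X \<phi> h" for \<mu> h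
    using that integral_ge_Inf_periodic_averages[OF _ g, of \<mu>] int_g[of \<mu>]
    unfolding integral_fiber_def a_def by auto
  have beta_le: "beta_fun lam X A \<phi> h \<le> c * h - a" if "h \<in> integral_range lam X \<phi>" for h
    unfolding beta_fun_def
  proof (rule cSUP_least[OF _ le])
    show "integral_fiber lam X \<phi> h \<noteq> {}"
      using that by (auto simp: integral_range_def integral_fiber_def)
  qed
  obtain \<mu> where \<mu>: "invariant \<mu>" "(\<integral>x. g x \<partial>\<mu>) = a"
    using minimizing_measure_exists[OF g] unfolding a_def by blast
  define h where "h = (\<integral>x. \<phi> x \<partial>\<mu>)"
  have h: "h \<in> integral_range lam X \<phi>" using \<mu>(1) by (auto simp: integral_range_def h_def)
  have fib: "\<mu> \<in> integral_fiber lam X \<phi> h" using \<mu>(1) by (simp add: integral_fiber_def h_def)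
  have "(\<integral>x. A x \<partial>\<mu>) \<le> beta_fun lam X A \<phi> h"
    unfolding beta_fun_def using le by (intro cSUP_upper fib bdd_aboveI2)
  then have "c * h - beta_fun lam X A \<phi> h = a"
    using beta_le[OF h] int_g[OF \<mu>(1)] \<mu>(2) by (simp add: h_def)
  then have "alpha_fun lam X A \<phi> c = a"
    unfolding alpha_fun_def using h beta_le by (intro Least_equality) force+
  then show ?thesis by (simp add: a_def g_def[abs_def])
qed

section \<open>Perturbing a periodic orbit\<close>

lemma between_integrals_in_interior:
  assumes \<phi>: "\<phi> \<in> C0 lam X" and \<mu>: "invariant \<mu>" and \<nu>: "invariant \<nu>"
    and r: "min (\<integral>x. \<phi> x \<partial>\<mu>) (\<integral>x. \<phi> x \<partial>\<nu>) < r" "r < max (\<integral>x. \<phi> x \<partial>\<mu>) (\<integral>x. \<phi> x \<partial>\<nu>)"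
  shows "r \<in> interior (integral_range lam X \<phi>)"
proof -
  define s t where "s = (\<integral>x. \<phi> x \<partial>\<mu>)" and "t = (\<integral>x. \<phi> x \<partial>\<nu>)"
  have "u \<in> integral_range lam X \<phi>" if u: "min s t < u" "u < max s t" for u
  proof -
    have "s \<noteq> t" using u by auto
    define \<tau> where "\<tau> = (u - t) / (s - t)"
    have \<tau>: "0 \<le> \<tau>" "\<tau> \<le> 1"
      using u by (auto simp: \<tau>_def min_def max_def divide_simps split: if_splits)
    obtain \<rho> where \<rho>: "invariant \<rho>" "(\<integral>x. \<phi> x \<partial>\<rho>) = \<tau> * s + (1 - \<tau>) * t"
      using invariant_measures_convex[OF \<mu> \<nu> \<tau>] \<phi> unfolding s_def t_def by metis
    have "\<tau> * s + (1 - \<tau>) * t = t + \<tau> * (s - t)" by (simp add: algebra_simps)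
    also have "\<dots> = u" using \<open>s \<noteq> t\<close> by (simp add: \<tau>_def)
    finally show ?thesis using \<rho> unfolding integral_range_def by force
  qed
  then have "{min s t<..<max s t} \<subseteq> interior (integral_range lam X \<phi>)"
    by (intro interior_maximal) auto
  then show ?thesis using r by (auto simp: s_def t_def)
qed

text \<open>The new orbit runs \<open>K\<close> times through the orbit of \<open>x\<close> and then once through a return path \<open>w\<close> of
  length \<open>n\<close> whose \<open>\<phi>\<close>-average \<open>d\<close> differs from that of \<open>x\<close>. Its \<open>\<phi>\<close>-average is exactly a proper
  convex combination of \<open>k\<close> and \<open>d\<close>, which are both integrals of \<open>\<phi>\<close> with respect to invariant
  measures. For \<open>g\<close>, the excursion contributes a bounded error, which large \<open>K\<close> makes negligible.\<close>

lemma perturb_average_into_interior: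
  assumes g: "g \<in> C0 lam X" and \<phi>: "\<phi> \<in> C0 lam X" "locally_constant X \<phi>"
    and ncob: "\<not> (\<exists>k. cohomologous lam X \<phi> (\<lambda>_. k))"
    and x: "x \<in> X" "0 < M" "(shift ^^ M) x = x" and e: "0 < e"
  obtains y q where "y \<in> X" "0 < q" "(shift ^^ q) y = y"
    "birkhoff_sum q g y / real q < birkhoff_sum M g x / real M + e"
    "birkhoff_sum q \<phi> y / real q \<in> interior (integral_range lam X \<phi>)"
proof -
  define b where "b = birkhoff_sum M g x / real M"
  define k where "k = birkhoff_sum M \<phi> x / real M"
  obtain G where G: "0 \<le> G" "\<And>x. x \<in> X \<Longrightarrow> \<bar>g x\<bar> \<le> G" using C0_bounded[OF g] by blast
  have e2: "0 < e / 2" using e by simp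
  obtain m0 where m0: "memory m0" using memory_exists ..
  obtain m1 where m1: "determined_by m1 X \<phi>" using locally_constant_imp_determined_by[OF \<phi>(2)] .
  obtain m2 where m2: "oscillation_below m2 (e/2) X g" using C0_oscillation[OF g e2] .
  \<comment> \<open>With prefixes of length \<open>m\<close>, paths can be glued, \<open>\<phi>\<close> is determined and \<open>g\<close> is determined up to
    \<open>e / 2\<close>.\<close>
  define m where "m = max m0 (max m1 m2)"
  have mem: "memory m" using memory_mono[OF m0] by (simp add: m_def)
  have det: "determined_by m X \<phi>" using determined_by_mono[OF m1] by (simp add: m_def)
  have osc: "oscillation_below m (e/2) X g" using oscillation_below_mono[OF m2] by (simp add: m_def)

  obtain w n where w: "w \<in> X" "agree m w x" "agree m ((shift ^^ n) w) x"
      "birkhoff_sum n \<phi> w \<noteq> real n * k"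
    using cohomologous_constant_if_return_averages_equal[OF det mem x(1), of k] ncob by blast
  have n: "0 < n" using w(4) by (cases n) (auto simp: birkhoff_sum_def)
  define d where "d = birkhoff_sum n \<phi> w / real n"
  have d: "birkhoff_sum n \<phi> w = real n * d" "d \<noteq> k" using n w(4) by (auto simp: d_def)
  have ww: "agree m ((shift ^^ n) w) w" using w(2,3) agree_sym agree_trans by blast
  \<comment> \<open>The return path closed up on its own realises \<open>d\<close> as an integral of \<open>\<phi>\<close>.\<close>
  define z where "z = periodize n w"
  have z: "z \<in> X" "(shift ^^ n) z = z" "agree (n + m) z w"
    unfolding z_def using periodize_in_X[OF mem w(1) n ww] funpow_shift_periodize
      agree_periodize[OF n ww] by blast+
  have zd: "birkhoff_sum n \<phi> z = real n * d"
    using birkhoff_sum_eq[OF det z(1) w(1) z(3)] d(1) by simp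

  \<comment> \<open>The sum of \<open>g\<close> over the excursion exceeds \<open>n * b\<close> by at most \<open>n * (G + abs b)\<close>; this has to be absorbed by \<open>e / 2\<close> per step on the repeated part.\<close>
  obtain K :: nat where K: "real n * (G + \<bar>b\<bar>) / (real M * (e/2)) < real K"
    using reals_Archimedean2 by blast
  have "0 \<le> real n * (G + \<bar>b\<bar>) / (real M * (e/2))" using G(1) e2 by simp
  then have "0 < K" using K by linarith
  have "0 < real M * (e/2)" using x(2) e2 by simp
  then have K': "real n * (G + \<bar>b\<bar>) < real (K * M) * (e/2)"
    using K by (simp add: pos_divide_less_eq mult_ac)
  have KM: "0 < K * M" using \<open>0 < K\<close> x(2) by simp
  have bx: "birkhoff_sum (K * M) g x = real (K * M) * b"
    and kx: "birkhoff_sum (K * M) \<phi> x = real (K * M) * k"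
    using birkhoff_sum_mult_period(2)[OF x(3)] x(2) by (simp_all add: b_def k_def)

  have gl: "agree m ((shift ^^ (K * M)) x) w"
    unfolding birkhoff_sum_mult_period(1)[OF x(3)] using w(2) by (rule agree_sym)
  define v where "v = glue (K * M) x w"
  have v: "v \<in> X" unfolding v_def by (rule glue_in_X[OF mem x(1) w(1) gl])
  have vx: "agree (K * M + m) v x" unfolding v_def by (rule agree_glue[OF gl])
  have sv: "(shift ^^ (K * M)) v = w" unfolding v_def by (rule funpow_shift_glue)
  define q where "q = K * M + n"
  have q: "0 < q" using n by (simp add: q_def)
  have "(shift ^^ q) v = (shift ^^ n) w"
    using funpow_shift_add[of n "K * M" v] sv by (simp add: q_def add.commute)
  then have vv: "agree m ((shift ^^ q) v) v"
    using w(3) agree_mono[OF vx, of m] agree_sym agree_trans by (metis le_add2)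
  define y where "y = periodize q v"
  have y: "y \<in> X" "(shift ^^ q) y = y" "agree (q + m) y v"
    unfolding y_def using periodize_in_X[OF mem v q vv] funpow_shift_periodize
      agree_periodize[OF q vv] by blast+
  have yx: "agree (K * M + m) y x"
    using agree_mono[OF y(3), of "K * M + m"] vx agree_trans unfolding q_def by force

  have "birkhoff_sum q \<phi> y = birkhoff_sum q \<phi> v" by (rule birkhoff_sum_eq[OF det y(1) v y(3)])
  also have "\<dots> = birkhoff_sum (K * M) \<phi> v + birkhoff_sum n \<phi> w"
    unfolding q_def birkhoff_sum_add sv ..
  also have "birkhoff_sum (K * M) \<phi> v = birkhoff_sum (K * M) \<phi> x"
    by (rule birkhoff_sum_eq[OF det v x(1) vx])
  finally have S\<phi>: "birkhoff_sum q \<phi> y = real (K * M) * k + real n * d" using kx d(1) by simp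

  have tail: "\<bar>birkhoff_sum n g ((shift ^^ (K * M)) y)\<bar> \<le> real n * G"
    by (rule birkhoff_sum_bound[OF G(2) funpow_shift_in_X[OF y(1)]])
  have "birkhoff_sum q g y = birkhoff_sum (K * M) g y + birkhoff_sum n g ((shift ^^ (K * M)) y)"
    unfolding q_def by (rule birkhoff_sum_add)
  also have "\<dots> \<le> (real (K * M) * b + real (K * M) * (e/2)) + real n * G"
    using birkhoff_sum_close[OF osc y(1) x(1) yx] bx tail by linarith
  also have "\<dots> < real q * (b + e)"
  proof -
    have "0 \<le> real n * (\<bar>b\<bar> + b)" "0 < real n * e" using n e by simp_all
    then have "real n * G < real n * b + real (K * M) * (e/2) + real n * e"
      using K' unfolding distrib_left by linarith
    then show ?thesis by (simp add: q_def algebra_simps)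
  qed
  finally have Sg: "birkhoff_sum q g y / real q < b + e"
    using q by (simp add: pos_divide_less_eq mult.commute)

  have "birkhoff_sum q \<phi> y / real q \<in> interior (integral_range lam X \<phi>)"
  proof (rule between_integrals_in_interior[OF \<phi>(1)])
    show "invariant (orbit_measure M x)" "invariant (orbit_measure n z)"
      using invariant_orbit_measure x z n by blast+
    have ik: "(\<integral>u. \<phi> u \<partial>orbit_measure M x) = k"
      using integral_orbit_measure[OF x(1,2) C0_measurable[OF \<phi>(1)]] by (simp add: k_def)
    have id: "(\<integral>u. \<phi> u \<partial>orbit_measure n z) = d"
      using integral_orbit_measure[OF z(1) n C0_measurable[OF \<phi>(1)]] zd n by simp
    define r where "r = birkhoff_sum q \<phi> y / real q"
    have rq: "r * real q = real (K * M) * k + real n * d" using q S\<phi> by (simp add: r_def)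
    have "(r - k) * real q = real n * (d - k)" "(d - r) * real q = real (K * M) * (d - k)"
      unfolding left_diff_distrib rq by (simp_all add: q_def algebra_simps)
    then have "r - k = real n / real q * (d - k)" "d - r = real (K * M) / real q * (d - k)"
      using q by (simp_all add: eq_divide_eq)
    moreover have "0 < real n / real q" "0 < real (K * M) / real q" using n q KM by simp_all
    ultimately have "(k < r \<and> r < d) \<or> (d < r \<and> r < k)"
      using d(2) by (smt (verit) mult_pos_pos mult_pos_neg)
    then show "min (\<integral>u. \<phi> u \<partial>orbit_measure M x) (\<integral>u. \<phi> u \<partial>orbit_measure n z) < birkhoff_sum q \<phi> y / real q"
      "birkhoff_sum q \<phi> y / real q < max (\<integral>u. \<phi> u \<partial>orbit_measure M x) (\<integral>u. \<phi> u \<partial>orbit_measure n z)"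
      unfolding ik id r_def[symmetric] by auto
  qed
  with y(1,2) q Sg show thesis unfolding b_def by (intro that)
qed

end

section \<open>Periodic orbits with interior average that nearly attain the minimum\<close>

theorem corollary15:
  fixes X :: "(nat \<Rightarrow> 'a::finite) set" and lam :: real
    and A \<phi> :: "(nat \<Rightarrow> 'a) \<Rightarrow> real" and c \<epsilon> :: real
  assumes "0 < lam" "lam < 1"
    and "subshift_of_finite_type X"
    and "transitive_shift lam X"
    and "\<phi> \<in> C0_rat lam X"
    and "locally_constant X \<phi>"
    and "\<not> (\<exists>k. cohomologous lam X \<phi> (\<lambda>_. k))"
    and "A \<in> C0 lam X"
    and "walters lam X A"
    and "\<epsilon> > 0"
  shows "\<exists>r \<mu>. r \<in> \<rat> \<and> r \<in> interior (integral_range lam X \<phi>) \<and>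
           periodic_measure lam X \<mu> \<and> \<mu> \<in> integral_fiber lam X \<phi> r \<and>
           c * r - integral\<^sup>L \<mu> A < alpha_fun lam X A \<phi> c + \<epsilon>"
proof -
  interpret sequence_space X lam using assms(1,2) by unfold_locales
  \<comment> \<open>On the empty space every function is vacuously cohomologous to a constant.\<close>
  have "X \<noteq> {}"
  proof
    assume "X = {}"
    have "(\<lambda>_. 0) \<in> C0 lam X" by (simp add: C0_iff)
    then have "cohomologous lam X \<phi> (\<lambda>_. 0)"
      unfolding cohomologous_def \<open>X = {}\<close> by (intro bexI[of _ "\<lambda>_. 0"]) auto
    then show False using assms(7) by blast
  qed
  then interpret transitive_sft X lam using assms(3,4) by unfold_locales
  have \<phi>: "\<phi> \<in> C0 lam X" and rat: "\<And>x. x \<in> X \<Longrightarrow> \<phi> x \<in> \<rat>"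
    using assms(5) by (auto simp: C0_rat_def)
  define g where "g x = c * \<phi> x - A x" for x
  have g: "g \<in> C0 lam X" using C0_linear_combination[OF \<phi> assms(8)] by (simp add: g_def[abs_def])
  have alpha: "alpha_fun lam X A \<phi> c = Inf (periodic_averages g)"
    using alpha_fun_eq_Inf_periodic_averages[OF \<phi> assms(8)] by (simp add: g_def[abs_def])
  have e: "0 < \<epsilon> / 2" using assms(10) by simp
  obtain x M where x: "x \<in> X" "0 < M" "(shift ^^ M) x = x"
      "birkhoff_sum M g x / real M < Inf (periodic_averages g) + \<epsilon> / 2"
    using periodic_average_near_Inf[OF g e] by blast
  obtain y q where y: "y \<in> X" "0 < q" "(shift ^^ q) y = y"
      "birkhoff_sum q g y / real q < birkhoff_sum M g x / real M + \<epsilon> / 2"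
      "birkhoff_sum q \<phi> y / real q \<in> interior (integral_range lam X \<phi>)"
    using perturb_average_into_interior[OF g \<phi> assms(6,7) x(1-3) e] by blast
  define r \<mu> where "r = birkhoff_sum q \<phi> y / real q" and "\<mu> = orbit_measure q y"
  have inv: "invariant \<mu>" unfolding \<mu>_def by (rule invariant_orbit_measure[OF y(1-3)])
  have int: "(\<integral>x. f x \<partial>\<mu>) = birkhoff_sum q f y / real q" if "f \<in> C0 lam X" for f
    unfolding \<mu>_def by (rule integral_orbit_measure[OF y(1,2) C0_measurable[OF that]])
  have "birkhoff_sum q \<phi> y \<in> \<rat>"
    unfolding birkhoff_sum_def by (intro Rats_sum rat funpow_shift_in_X y(1))
  then have "r \<in> \<rat>" unfolding r_def by (intro Rats_divide) auto
  moreover have "periodic_measure lam X \<mu>"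
    unfolding \<mu>_def by (rule periodic_orbit_measure[OF y(1-3)])
  moreover have "\<mu> \<in> integral_fiber lam X \<phi> r"
    using inv int[OF \<phi>] by (simp add: integral_fiber_def r_def)
  moreover have "(\<integral>x. g x \<partial>\<mu>) = c * r - (\<integral>x. A x \<partial>\<mu>)"
    unfolding g_def using C0_integrable[OF inv \<phi>] C0_integrable[OF inv assms(8)] int[OF \<phi>]
    by (simp add: r_def)
  then have "c * r - (\<integral>x. A x \<partial>\<mu>) < alpha_fun lam X A \<phi> c + \<epsilon>"
    unfolding alpha using int[OF g] x(4) y(4) by linarith
  ultimately show ?thesis using y(5) unfolding r_def by blast
qed

end
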